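(* Consider the mixed-order system consisting of the augmented Israel–Stewart/DNMR fluid equations coupled to Einstein's equations (with or without cosmological constant) in harmonic gauge, with principal part $\mathbb A(\phi)$ as described in the context, at states satisfying $u^\alpha u_\alpha=-1$, $\pi^{[\mu\nu]}=0$, $u_\alpha\pi^{\alpha\mu}=0$, $\pi^\alpha{}_\alpha=0$. Then this coupled system is causal if and only if the matter part satisfies: $\tau_\Pi,\tau_\pi\ne0$, $E+\Lambda_A\ne0$ for $A=0,1,2,3$, and for all $\chi^2,\kappa^2\in[0,1]$ $$0\le\Delta(\mathcal P_3;\chi^2,\kappa^2),\qquad 0\le\tfrac{\mathcal A_2}{3}\le1,\quad 0\le\mathcal A_1,\quad 0\le\mathcal A_0,$$ $$0\le1-\mathcal A_2+\mathcal A_1-\mathcal A_0,\qquad 0\le1-\tfrac23\mathcal A_2+\tfrac13\mathcal A_1,\qquad 0\le\frac{\frac12(2\eta+\lambda_{\pi\Pi}\Pi)+\frac14\tau_{\pi\pi}\Lambda_{\hat v^2}}{\tau_\pi E}\le1 .$$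
   Context: **Matter sector.** $g$ is a Lorentzian metric of signature $(-,+,+,+)$ on a 4-manifold, now dynamical; $\nabla$ is its Levi-Civita connection; Greek indices run over $0,\dots,3$; $A^{(\mu\nu)}$, $A^{[\mu\nu]}$ denote symmetrization/antisymmetrization with factor $\frac12$. The matter unknowns are $\mathbf U_M=(u^\nu,\varepsilon,n,\Pi,\pi^{\nu0},\dots,\pi^{\nu3})^T\in\mathbb R^{23}$, all components independent. $P=P(\varepsilon,n)$ is a given sufficiently smooth function, $P_\varepsilon=(\partial P/\partial\varepsilon)_n$, $P_n=(\partial P/\partial n)_\varepsilon$. The transport coefficients $\tau_\Pi,\zeta,\delta_{\Pi\Pi},\lambda_{\Pi\pi},\tau_\pi,\eta,\delta_{\pi\pi},\tau_{\pi\pi},\lambda_{\pi\Pi}$ are given functions of $(\varepsilon,n,\Pi,\pi_{\alpha\beta}\pi^{\alpha\beta})$. $E=\varepsilon+P+\Pi$, $\Delta^{\mu\nu}=g^{\mu\nu}+u^\mu u^\nu$. The matter equations $(\mathbb A_M^\alpha\partial_\alpha+\mathbb B_M)\mathbf U_M=\mathbf0$ are $$\begin{aligned} 0&=u^\alpha\nabla_\alpha\varepsilon+E\nabla_\alpha u^\alpha+\pi^\alpha{}_\nu\nabla_\alpha u^\nu,\\ 0&=Eu^\alpha\nabla_\alpha u^\mu+\Delta^{\mu\alpha}\nabla_\alpha(P+\Pi)+\nabla_\alpha\pi^{\mu\alpha}-u^\mu\pi^{\alpha\beta}\nabla_\beta u_\alpha,\\ 0&=n\nabla_\alpha u^\alpha+u^\alpha\nabla_\alpha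 n,\\ \Pi+\tau_\Pi u^\alpha\nabla_\alpha\Pi&=-[(\zeta+\delta_{\Pi\Pi}\Pi)g^\alpha{}_\nu+\lambda_{\Pi\pi}\pi^\alpha{}_\nu]\nabla_\alpha u^\nu,\\ \pi^{\mu\beta}+\tau_\pi u^\alpha\nabla_\alpha\pi^{\mu\beta}&=-\mathcal C_\pi{}^{\mu\beta\alpha}{}_\nu\nabla_\alpha u^\nu, \end{aligned}$$ $$\begin{aligned}\mathcal C_\pi{}^{\mu\beta\alpha}{}_\nu=&\big(\eta+\tfrac12\lambda_{\pi\Pi}\Pi\big)\big(\Delta^{\mu\alpha}g^\beta{}_\nu+\Delta^{\beta\alpha}g^\mu{}_\nu-\tfrac23\Delta^{\mu\beta}\Delta^\alpha{}_\nu\big)-2\tau_\pi u^\alpha\pi^{(\mu}{}_\nu u^{\beta)}+\big(\delta_{\pi\pi}-\tfrac{\tau_{\pi\pi}}3\big)\pi^{\mu\beta}g^\alpha{}_\nu\\&+\tfrac{\tau_{\pi\pi}}2\big(\Delta^{\alpha(\beta}\pi^{\mu)}{}_\nu+\pi^{\alpha(\mu}g^{\beta)}{}_\nu\big)-\tfrac{\tau_{\pi\pi}}3\Delta^{\mu\beta}\pi^\alpha{}_\nu .\end{aligned}$$ For a covector $\phi_\mu$ put $z=u^\alpha\phi_\alpha$, $v^\mu=\Delta^{\mu\alpha}\phi_\alpha$, $w^\mu=\pi^{\mu\alpha}\phi_\alpha$. $\mathbb A_M^\alpha\phi_\alpha$ maps $(\delta u^\nu,\delta\varepsilon,\delta n,\delta\Pi,\delta\pi^{\nu\beta})$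 to the tuple with entries (i) $Ez\,\delta u^\mu-u^\mu w_\nu\delta u^\nu+v^\mu(P_\varepsilon\delta\varepsilon+P_n\delta n+\delta\Pi)+\phi_\beta\delta\pi^{\mu\beta}$; (ii) $(E\phi_\nu+w_\nu)\delta u^\nu+z\,\delta\varepsilon$; (iii) $n\phi_\nu\delta u^\nu+z\,\delta n$; (iv) $[(\zeta+\delta_{\Pi\Pi}\Pi)\phi_\nu+\lambda_{\Pi\pi}w_\nu]\delta u^\nu+\tau_\Pi z\,\delta\Pi$; (v) $\phi_\alpha\mathcal C_\pi{}^{\mu\beta\alpha}{}_\nu\delta u^\nu+\tau_\pi z\,\delta\pi^{\mu\beta}$. **Eigenvalues and the cubic.** At a state satisfying the constraints, $\pi^\mu{}_\nu$ has an orthonormal eigenbasis $e_0=u,e_1,e_2,e_3$ with eigenvalues $\Lambda_0=0,\Lambda_1,\Lambda_2,\Lambda_3$, $\Lambda_1+\Lambda_2+\Lambda_3=0$. Write $v^2=v_\alpha v^\alpha$, $v_a=v_\alpha e_a^\alpha$, $\hat z=z/v$, $\hat v_a^2=v_a^2/v^2$, parametrized by $\chi^2,\kappa^2\in[0,1]$ via $\hat v_1^2=\chi^2(1-\kappa^2)$, $\hat v_2^2=(1-\chi^2)(1-\kappa^2)$, $\hat v_3^2=\kappa^2$; $\Lambda_{\hat v^2}=\sum_{k=1}^3\Lambda_k\hat v_k^2$. When $\tau_\Pi,\tau_\pi,E+\Lambda_A\ne0$, the functions $\mathcal A_k(\chi^2,\kappa^2)$ are defined by $$\det(\mathbb A_M^\alpha\phi_\alpha)=\Big[\prod_{k=0}^3(E+\Lambda_k)\Big]v^{23}\tau_\Pi\tau_\pi^{16}\hat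 z^{15}\Big[\hat z^2-\tfrac{\frac12(2\eta+\lambda_{\pi\Pi}\Pi)+\frac14\tau_{\pi\pi}\Lambda_{\hat v^2}}{\tau_\pi E}\Big]\mathcal P_3,\qquad \mathcal P_3=\hat z^6-\mathcal A_2\hat z^4+\mathcal A_1\hat z^2-\mathcal A_0,$$ and $\Delta(\mathcal P_3;\chi^2,\kappa^2)=-27\big[2(\tfrac{\mathcal A_2}{3})^3-\tfrac{\mathcal A_2}{3}\mathcal A_1+\mathcal A_0\big]^2-4\big[\mathcal A_1-3(\tfrac{\mathcal A_2}{3})^2\big]^3$. **Gravity sector.** Einstein's equations $\mathcal R_{\mu\nu}-\frac12\mathcal Rg_{\mu\nu}+\Lambda g_{\mu\nu}=8\pi G\,T_{\mu\nu}$ with $T^{\mu\nu}=\varepsilon u^\mu u^\nu+(P+\Pi)\Delta^{\mu\nu}+\pi^{\mu\nu}$, in harmonic gauge $g^{\alpha\beta}\Gamma^\mu_{\alpha\beta}=0$, take the form $-\frac12g^{\alpha\beta}\partial_\alpha\partial_\beta g_{\mu\nu}=(\text{terms depending only on }g,\partial g,\mathbf U_M)$. The unknowns of the coupled system are $\mathbf U_M$ and the 10 components $g_{\mu\nu}$, $\mu\le\nu$ (33 in total). Its principal part (first-order derivatives of matter variables in the matter equations, second-order derivatives of the metric in the gravity equations) is the block-diagonal matrix $$\mathbb A(\phi)=\begin{bmatrix}\mathbb A_M^\alpha\phi_\alpha&0\\0&g^{\alpha\beta}\phi_\alpha\phi_\beta I_{10}\end{bmatrix}.$$ **Causality.** The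 coupled system is *causal* if (CI) the roots $\phi_0=\phi_0(\phi_i)$ of $\det\mathbb A(\phi)=0$ (for real spatial components $\phi_i$, with respect to coordinates whose level sets of $x^0$ are spacelike) are all real, and (CII) every characteristic covector $\phi$ so obtained is non-timelike, $\phi^\alpha\phi_\alpha\ge0$. *)

theory Defs
  imports "HOL-Analysis.Analysis"
begin

section \<open>Spacetime metric at a point\<close>

text \<open>
  Everything is evaluated at one spacetime point, in one coordinate system.  Greek indices range
  over the numeral type \<open>4\<close>, whose elements are 0, 1, 2, 3 (with 4 = 0); index 0 is the
  time coordinate.  \<open>g\<close> has the covariant components, so \<open>matrix_inv g\<close> is the inverse metric.
\<close>

definition gprod :: "real^4^4 \<Rightarrow> real^4 \<Rightarrow> real^4 \<Rightarrow> real" where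
  "gprod g X Y = (\<Sum>\<mu>\<in>UNIV. \<Sum>\<nu>\<in>UNIV. g$\<mu>$\<nu> * X$\<mu> * Y$\<nu>)"

definition minkowski :: "real^4^4" where
  "minkowski = (\<chi> \<mu> \<nu>. if \<mu> = \<nu> then (if \<mu> = 0 then -1 else 1) else 0)"

definition lorentzian :: "real^4^4 \<Rightarrow> bool" where
  "lorentzian g \<longleftrightarrow> (\<exists>F. invertible F \<and> transpose F ** g ** F = minkowski)"

text \<open>The vectors tangent to the level sets of the time coordinate are those with \<open>X$0 = 0\<close>.\<close>

definition spacelike_level_sets :: "real^4^4 \<Rightarrow> bool" where
  "spacelike_level_sets g \<longleftrightarrow> (\<forall>X. X$0 = 0 \<and> X \<noteq> 0 \<longrightarrow> gprod g X X > 0)"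

section \<open>Matter sector\<close>

text \<open>The unknowns form a vector in \<open>real^matter_var\<close>, of dimension 23.  The shear stress has 16
  independent components, not assumed symmetric; a velocity or shear index is an upper index.\<close>

datatype matter_var =
  Velocity "4" | Energy | Density | Bulk | Shear "4" "4"

lemma UNIV_matter_var:
  "UNIV = range Velocity \<union> {Energy, Density, Bulk} \<union> range (\<lambda>(\<mu>, \<nu>). Shear \<mu> \<nu>)"
proof (rule UNIV_eq_I)
  fix x show "x \<in> range Velocity \<union> {Energy, Density, Bulk} \<union> range (\<lambda>(\<mu>, \<nu>). Shear \<mu> \<nu>)"
    by (cases x) auto
qed

instance matter_var :: finite
  by standard (simp add: UNIV_matter_var)

text \<open>A transport coefficient is a function of \<open>\<epsilon>\<close>, \<open>n\<close>, \<open>\<Pi>\<close> and the square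
  \<open>\<pi>\<^sub>\<alpha>\<^sub>\<beta> \<pi>\<^sup>\<alpha>\<^sup>\<beta>\<close>.  In the field names, \<open>Pi\<close> refers to the bulk scalar and \<open>pi\<close> to the shear
  tensor.\<close>

type_synonym transport = "real \<Rightarrow> real \<Rightarrow> real \<Rightarrow> real \<Rightarrow> real"

record fluid_model =
  pressure :: "real \<Rightarrow> real \<Rightarrow> real"
  tau_Pi :: transport
  zeta :: transport
  delta_PiPi :: transport
  lambda_Pipi :: transport
  tau_pi :: transport
  eta :: transport
  delta_pipi :: transport
  tau_pipi :: transport
  lambda_piPi :: transport

definition kron :: "4 \<Rightarrow> 4 \<Rightarrow> real" where
  "kron \<mu> \<nu> = (if \<mu> = \<nu> then 1 else 0)"

definition symmetrize :: "(4 \<Rightarrow> 4 \<Rightarrow> real) \<Rightarrow> 4 \<Rightarrow> 4 \<Rightarrow> real" where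
  "symmetrize A \<mu> \<beta> = (A \<mu> \<beta> + A \<beta> \<mu>) / 2"

context
  fixes g :: "real^4^4" and M :: fluid_model and U :: "real^matter_var"
begin

definition vel :: "real^4" where
  "vel = (\<chi> \<mu>. U $ Velocity \<mu>)"

definition shear :: "real^4^4" where
  "shear = (\<chi> \<mu> \<nu>. U $ Shear \<mu> \<nu>)"

text \<open>Mixed components: first index up, second index down.\<close>

definition shear_mixed :: "real^4^4" where
  "shear_mixed = shear ** g"

definition proj :: "real^4^4" where
  "proj = (\<chi> \<mu> \<nu>. matrix_inv g $\<mu>$\<nu> + vel$\<mu> * vel$\<nu>)"

definition proj_mixed :: "real^4^4" where
  "proj_mixed = proj ** g"

definition shear_square :: real where
  "shear_square = (\<Sum>\<alpha>\<in>UNIV. \<Sum>\<beta>\<in>UNIV. \<Sum>\<mu>\<in>UNIV. \<Sum>\<nu>\<in>UNIV.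
      g$\<alpha>$\<mu> * g$\<beta>$\<nu> * shear$\<mu>$\<nu> * shear$\<alpha>$\<beta>)"

definition coef :: "(fluid_model \<Rightarrow> transport) \<Rightarrow> real" where
  "coef c = c M (U$Energy) (U$Density) (U$Bulk) shear_square"

definition P_eps :: real where
  "P_eps = deriv (\<lambda>\<epsilon>. pressure M \<epsilon> (U$Density)) (U$Energy)"

definition P_n :: real where
  "P_n = deriv (\<lambda>n. pressure M (U$Energy) n) (U$Density)"

definition enthalpy :: real where
  "enthalpy = U$Energy + pressure M (U$Energy) (U$Density) + U$Bulk"

text \<open>\<open>C_shear \<mu> \<beta> \<alpha> \<nu>\<close> has \<open>\<mu>\<close>, \<open>\<beta>\<close>, \<open>\<alpha>\<close> as upper indices and \<open>\<nu>\<close> as lower index.\<close>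

definition C_shear :: "4 \<Rightarrow> 4 \<Rightarrow> 4 \<Rightarrow> 4 \<Rightarrow> real" where
  "C_shear \<mu> \<beta> \<alpha> \<nu> =
     (coef eta + 1/2 * coef lambda_piPi * U$Bulk) *
       (proj$\<mu>$\<alpha> * kron \<beta> \<nu> + proj$\<beta>$\<alpha> * kron \<mu> \<nu> - 2/3 * proj$\<mu>$\<beta> * proj_mixed$\<alpha>$\<nu>)
     - 2 * coef tau_pi * vel$\<alpha> * symmetrize (\<lambda>\<mu> \<beta>. shear_mixed$\<mu>$\<nu> * vel$\<beta>) \<mu> \<beta>
     + (coef delta_pipi - coef tau_pipi / 3) * shear$\<mu>$\<beta> * kron \<alpha> \<nu>
     + coef tau_pipi / 2 *
         (symmetrize (\<lambda>\<beta> \<mu>. proj$\<alpha>$\<beta> * shear_mixed$\<mu>$\<nu>) \<beta> \<mu>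
          + symmetrize (\<lambda>\<mu> \<beta>. shear$\<alpha>$\<mu> * kron \<beta> \<nu>) \<mu> \<beta>)
     - coef tau_pipi / 3 * proj$\<mu>$\<beta> * shear_mixed$\<alpha>$\<nu>"

text \<open>
  \<open>matter_op \<alpha> \<delta>\<close> collects, equation by equation, the terms of the matter system in which the
  unknowns are differentiated in direction \<open>\<alpha>\<close>, with \<open>\<delta>\<close> in place of that derivative of
  the unknowns; \<open>\<nabla>\<^sub>\<alpha> p = P_eps \<nabla>\<^sub>\<alpha> \<epsilon> + P_n \<nabla>\<^sub>\<alpha> n\<close> for the pressure.  The component
  \<open>Velocity \<mu>\<close> is the momentum equation, \<open>Energy\<close> the energy equation, \<open>Density\<close> particle
  conservation, and \<open>Bulk\<close>, \<open>Shear \<mu> \<beta>\<close> the two relaxation equations.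
\<close>

definition matter_op :: "4 \<Rightarrow> real^matter_var \<Rightarrow> real^matter_var" where
  "matter_op \<alpha> \<delta> = (\<chi> row. case row of
      Velocity \<mu> \<Rightarrow>
        enthalpy * vel$\<alpha> * \<delta>$Velocity \<mu>
        + proj$\<mu>$\<alpha> * (P_eps * \<delta>$Energy + P_n * \<delta>$Density + \<delta>$Bulk)
        + \<delta>$Shear \<mu> \<alpha>
        - vel$\<mu> * (\<Sum>\<beta>\<in>UNIV. shear$\<beta>$\<alpha> * (\<Sum>\<nu>\<in>UNIV. g$\<beta>$\<nu> * \<delta>$Velocity \<nu>))
    | Energy \<Rightarrow>
        vel$\<alpha> * \<delta>$Energy + enthalpy * \<delta>$Velocity \<alpha>
        + (\<Sum>\<nu>\<in>UNIV. shear_mixed$\<alpha>$\<nu> * \<delta>$Velocity \<nu>)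
    | Density \<Rightarrow> U$Density * \<delta>$Velocity \<alpha> + vel$\<alpha> * \<delta>$Density
    | Bulk \<Rightarrow>
        coef tau_Pi * vel$\<alpha> * \<delta>$Bulk
        + (\<Sum>\<nu>\<in>UNIV. ((coef zeta + coef delta_PiPi * U$Bulk) * kron \<alpha> \<nu>
                     + coef lambda_Pipi * shear_mixed$\<alpha>$\<nu>) * \<delta>$Velocity \<nu>)
    | Shear \<mu> \<beta> \<Rightarrow>
        coef tau_pi * vel$\<alpha> * \<delta>$Shear \<mu> \<beta>
        + (\<Sum>\<nu>\<in>UNIV. C_shear \<mu> \<beta> \<alpha> \<nu> * \<delta>$Velocity \<nu>))"

definition A_M :: "4 \<Rightarrow> real^matter_var^matter_var" where
  "A_M \<alpha> = matrix (matter_op \<alpha>)"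

text \<open>The covector may have real or complex components (\<open>'a = real\<close> or \<open>'a = complex\<close>).\<close>

definition matter_symbol :: "('a::real_field)^4 \<Rightarrow> 'a^matter_var^matter_var" where
  "matter_symbol \<phi> = (\<chi> r c. \<Sum>\<alpha>\<in>UNIV. of_real (A_M \<alpha> $r$c) * \<phi>$\<alpha>)"

section \<open>Coupled system and causality\<close>

definition cometric :: "('a::real_field)^4 \<Rightarrow> 'a" where
  "cometric \<phi> = (\<Sum>\<alpha>\<in>UNIV. \<Sum>\<beta>\<in>UNIV. of_real (matrix_inv g $\<alpha>$\<beta>) * \<phi>$\<alpha> * \<phi>$\<beta>)"

text \<open>The summand \<open>10\<close> of the index type enumerates the components \<open>g\<^sub>\<mu>\<^sub>\<nu>\<close>, \<open>\<mu> \<le> \<nu>\<close>, on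
  which the reduced Einstein operator in harmonic gauge has scalar principal part; a cosmological
  constant enters only at order zero.\<close>

definition coupled_symbol ::
    "('a::real_field)^4 \<Rightarrow> 'a^(matter_var + 10)^(matter_var + 10)" where
  "coupled_symbol \<phi> = (\<chi> r c. case (r, c) of
      (Inl i, Inl j) \<Rightarrow> matter_symbol \<phi> $i$j
    | (Inr i, Inr j) \<Rightarrow> if i = j then cometric \<phi> else 0
    | _ \<Rightarrow> 0)"

text \<open>Condition (CI): for real spatial components (all zero included) every complex root \<open>\<phi>\<^sub>0\<close> of the
  characteristic polynomial is real.  If the polynomial in \<open>\<phi>\<^sub>0\<close> vanishes identically, every
  complex number is a root and the condition fails.\<close>

definition causal :: bool where
  "causal \<longleftrightarrow>
     (\<forall>\<phi>::complex^4. (\<forall>i. i \<noteq> 0 \<longrightarrow> \<phi>$i \<in> \<real>) \<and> det (coupled_symbol \<phi>) = 0 \<longrightarrow> \<phi>$0 \<in> \<real>) \<and>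
     (\<forall>\<phi>::real^4. det (coupled_symbol \<phi>) = 0 \<longrightarrow> cometric \<phi> \<ge> 0)"

section \<open>Constraints, eigenframe and the cubic\<close>

text \<open>\<open>u\<^sub>\<alpha> u\<^sup>\<alpha> = -1\<close>, symmetry, transversality and tracelessness of the shear stress.\<close>

definition constraints :: bool where
  "constraints \<longleftrightarrow>
     gprod g vel vel = -1 \<and>
     (\<forall>\<mu> \<nu>. (shear$\<mu>$\<nu> - shear$\<nu>$\<mu>) / 2 = 0) \<and>
     (\<forall>\<mu>. (\<Sum>\<alpha>\<in>UNIV. (g *v vel)$\<alpha> * shear$\<alpha>$\<mu>) = 0) \<and>
     (\<Sum>\<alpha>\<in>UNIV. shear_mixed$\<alpha>$\<alpha>) = 0"

definition eigenframe :: "(4 \<Rightarrow> real^4) \<Rightarrow> (4 \<Rightarrow> real) \<Rightarrow> bool" where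
  "eigenframe e \<Lambda> \<longleftrightarrow>
     e 0 = vel \<and> \<Lambda> 0 = 0 \<and>
     (\<forall>a b. gprod g (e a) (e b) = minkowski$a$b) \<and>
     (\<forall>a. shear_mixed *v e a = \<Lambda> a *\<^sub>R e a)"

definition zz :: "real^4 \<Rightarrow> real" where
  "zz \<phi> = (\<Sum>\<alpha>\<in>UNIV. vel$\<alpha> * \<phi>$\<alpha>)"

definition vv :: "real^4 \<Rightarrow> real^4" where
  "vv \<phi> = proj *v \<phi>"

definition vnorm :: "real^4 \<Rightarrow> real" where
  "vnorm \<phi> = sqrt (gprod g (vv \<phi>) (vv \<phi>))"

definition zhat :: "real^4 \<Rightarrow> real" where
  "zhat \<phi> = zz \<phi> / vnorm \<phi>"

definition vhat_sq :: "(4 \<Rightarrow> real^4) \<Rightarrow> real^4 \<Rightarrow> 4 \<Rightarrow> real" where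
  "vhat_sq e \<phi> a = (gprod g (vv \<phi>) (e a))\<^sup>2 / (vnorm \<phi>)\<^sup>2"

text \<open>The arguments \<open>c\<close>, \<open>k\<close> stand for \<open>\<chi>\<^sup>2\<close>, \<open>\<kappa>\<^sup>2\<close>.  Index 0 is never used.\<close>

definition dir_sq :: "real \<Rightarrow> real \<Rightarrow> 4 \<Rightarrow> real" where
  "dir_sq c k a =
     (if a = 1 then c * (1 - k) else if a = 2 then (1 - c) * (1 - k) else if a = 3 then k else 0)"

definition Lambda_dir :: "(4 \<Rightarrow> real) \<Rightarrow> real \<Rightarrow> real \<Rightarrow> real" where
  "Lambda_dir \<Lambda> c k = (\<Sum>a\<in>{1, 2, 3}. \<Lambda> a * dir_sq c k a)"

definition speed_sq :: "(4 \<Rightarrow> real) \<Rightarrow> real \<Rightarrow> real \<Rightarrow> real" where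
  "speed_sq \<Lambda> c k =
     (1/2 * (2 * coef eta + coef lambda_piPi * U$Bulk) + 1/4 * coef tau_pipi * Lambda_dir \<Lambda> c k)
     / (coef tau_pi * enthalpy)"

text \<open>The triple \<open>(A2, A1, A0)\<close> is the unique one for which the factorization of the matter
  determinant holds at all covectors pointing in the direction encoded by \<open>c\<close>, \<open>k\<close>.  It is
  meaningful for \<open>c\<close>, \<open>k\<close> in the unit interval when the relaxation times and all
  \<open>enthalpy + \<Lambda> a\<close> are nonzero.\<close>

definition cubic_coeffs ::
    "(4 \<Rightarrow> real^4) \<Rightarrow> (4 \<Rightarrow> real) \<Rightarrow> real \<Rightarrow> real \<Rightarrow> real \<times> real \<times> real" where
  "cubic_coeffs e \<Lambda> c k = (THE (A2, A1, A0).
     \<forall>\<phi>. vnorm \<phi> \<noteq> 0 \<and> (\<forall>a\<in>{1, 2, 3}. vhat_sq e \<phi> a = dir_sq c k a) \<longrightarrow>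
       det (matter_symbol \<phi>) =
         (\<Prod>a\<in>UNIV. enthalpy + \<Lambda> a) * vnorm \<phi> ^ 23 * coef tau_Pi * coef tau_pi ^ 16
         * zhat \<phi> ^ 15 * (zhat \<phi> ^ 2 - speed_sq \<Lambda> c k)
         * (zhat \<phi> ^ 6 - A2 * zhat \<phi> ^ 4 + A1 * zhat \<phi> ^ 2 - A0))"

end

lemma linear_matter_op: "linear (matter_op g M U \<alpha>)"
proof (rule linearI)
  fix x y :: "real^matter_var" and r :: real
  show "matter_op g M U \<alpha> (x + y) = matter_op g M U \<alpha> x + matter_op g M U \<alpha> y"
    by (simp add: matter_op_def vec_eq_iff sum.distrib distrib_left split: matter_var.split)
  show "matter_op g M U \<alpha> (r *\<^sub>R x) = r *\<^sub>R matter_op g M U \<alpha> x"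
    by (simp add: matter_op_def vec_eq_iff sum_distrib_left distrib_left right_diff_distrib
        mult.left_commute split: matter_var.split)
qed

lemma matter_symbol_mult:
  "matter_symbol g M U \<phi> *v \<delta> = (\<Sum>\<alpha>\<in>UNIV. \<phi>$\<alpha> *\<^sub>R matter_op g M U \<alpha> \<delta>)"
proof -
  have "(matter_symbol g M U \<phi> *v \<delta>) $ i = (\<Sum>\<alpha>\<in>UNIV. \<phi>$\<alpha> * (A_M g M U \<alpha> *v \<delta>) $ i)" for i
    unfolding matter_symbol_def matrix_vector_mult_def
    by (simp add: sum_distrib_right, subst sum.swap) (simp add: sum_distrib_left mult_ac)
  moreover have "A_M g M U \<alpha> *v \<delta> = matter_op g M U \<alpha> \<delta>" for \<alpha>
    unfolding A_M_def by (rule matrix_works) (simp add: linear_matter_op linear_matrix_vector_mul_eq)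
  ultimately show ?thesis
    by (simp add: vec_eq_iff)
qed

text \<open>At symmetric shear the contracted symbol takes the familiar form in terms of
  \<open>z = u\<^sup>\<alpha> \<phi>\<^sub>\<alpha>\<close>, \<open>v\<^sup>\<mu> = \<Delta>\<^sup>\<mu>\<^sup>\<alpha> \<phi>\<^sub>\<alpha>\<close> and \<open>w\<^sub>\<nu> = \<phi>\<^sub>\<alpha> \<pi>\<^sup>\<alpha>\<^sub>\<nu>\<close>.\<close>

lemma matter_symbol_entries:
  fixes g M U \<phi> \<delta>
  defines "E \<equiv> enthalpy M U" and "z \<equiv> zz U \<phi>" and "v \<equiv> vv g U \<phi>"
    and "w \<equiv> transpose (shear_mixed g U) *v \<phi>"
    and "S \<equiv> matter_symbol g M U \<phi> *v \<delta>"
  assumes sym: "\<forall>\<mu> \<nu>. shear U$\<mu>$\<nu> = shear U$\<nu>$\<mu>"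
  shows
    "S$Velocity \<mu> = E * z * \<delta>$Velocity \<mu> - vel U$\<mu> * (\<Sum>\<nu>\<in>UNIV. w$\<nu> * \<delta>$Velocity \<nu>)
       + v$\<mu> * (P_eps M U * \<delta>$Energy + P_n M U * \<delta>$Density + \<delta>$Bulk)
       + (\<Sum>\<beta>\<in>UNIV. \<phi>$\<beta> * \<delta>$Shear \<mu> \<beta>)" (is ?vel)
    "S$Energy = (\<Sum>\<nu>\<in>UNIV. (E * \<phi>$\<nu> + w$\<nu>) * \<delta>$Velocity \<nu>) + z * \<delta>$Energy" (is ?energy)
    "S$Density = U$Density * (\<Sum>\<nu>\<in>UNIV. \<phi>$\<nu> * \<delta>$Velocity \<nu>) + z * \<delta>$Density" (is ?density)
    "S$Bulk = (\<Sum>\<nu>\<in>UNIV. ((coef g M U zeta + coef g M U delta_PiPi * U$Bulk) * \<phi>$\<nu>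
                 + coef g M U lambda_Pipi * w$\<nu>) * \<delta>$Velocity \<nu>)
       + coef g M U tau_Pi * z * \<delta>$Bulk" (is ?bulk)
    "S$Shear \<mu> \<beta> = (\<Sum>\<alpha>\<in>UNIV. \<phi>$\<alpha> * (\<Sum>\<nu>\<in>UNIV. C_shear g M U \<mu> \<beta> \<alpha> \<nu> * \<delta>$Velocity \<nu>))
       + coef g M U tau_pi * z * \<delta>$Shear \<mu> \<beta>" (is ?shear)
proof -
  define q where "q \<alpha> = (\<Sum>\<nu>\<in>UNIV. shear_mixed g U $\<alpha>$\<nu> * \<delta>$Velocity \<nu>)" for \<alpha>
  have S: "S $ r = (\<Sum>\<alpha>\<in>UNIV. \<phi>$\<alpha> * matter_op g M U \<alpha> \<delta> $ r)" for r
    by (simp add: S_def matter_symbol_mult)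
  have wq: "(\<Sum>\<nu>\<in>UNIV. w$\<nu> * \<delta>$Velocity \<nu>) = (\<Sum>\<alpha>\<in>UNIV. \<phi>$\<alpha> * q \<alpha>)"
    unfolding w_def q_def matrix_vector_mult_def transpose_def
    by (simp add: sum_distrib_right sum_distrib_left, subst sum.swap) (simp add: mult_ac)
  have kq: "(\<Sum>\<nu>\<in>UNIV. (a * kron \<alpha> \<nu> + b * shear_mixed g U $\<alpha>$\<nu>) * \<delta>$Velocity \<nu>)
      = a * \<delta>$Velocity \<alpha> + b * q \<alpha>" for a b \<alpha>
    by (simp add: q_def kron_def distrib_right sum.distrib sum_distrib_left mult.assoc
        if_distrib [where f = "\<lambda>x. _ * x"] if_distrib [where f = "\<lambda>x. x * _"] cong: if_cong)
  have "shear_mixed g U $\<alpha>$\<nu> = (\<Sum>\<beta>\<in>UNIV. shear U $\<beta>$\<alpha> * g$\<beta>$\<nu>)" for \<alpha> \<nu>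
    using sym by (simp add: shear_mixed_def matrix_matrix_mult_def)
  then have uq: "(\<Sum>\<beta>\<in>UNIV. shear U $\<beta>$\<alpha> * (\<Sum>\<nu>\<in>UNIV. g$\<beta>$\<nu> * \<delta>$Velocity \<nu>)) = q \<alpha>" for \<alpha>
    unfolding q_def by (simp add: sum_distrib_right sum_distrib_left, subst sum.swap) (simp add: mult_ac)
  have pv: "v$\<mu> = (\<Sum>\<alpha>\<in>UNIV. \<phi>$\<alpha> * proj g U $\<mu>$\<alpha>)"
    by (simp add: v_def vv_def matrix_vector_mult_def mult.commute)
  note dist = sum.distrib sum_subtractf sum_distrib_left sum_distrib_right distrib_left distrib_right
    right_diff_distrib
  have e: "(\<Sum>\<nu>\<in>UNIV. (a * \<phi>$\<nu> + b * w$\<nu>) * \<delta>$Velocity \<nu>)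
      = a * (\<Sum>\<nu>\<in>UNIV. \<phi>$\<nu> * \<delta>$Velocity \<nu>) + b * (\<Sum>\<alpha>\<in>UNIV. \<phi>$\<alpha> * q \<alpha>)" for a b
    unfolding wq [symmetric] by (simp add: dist mult_ac)
  show ?vel
    unfolding S wq pv z_def zz_def E_def
    by (simp add: matter_op_def uq) (simp add: dist mult_ac)
  show ?energy
    unfolding S z_def zz_def E_def using e [of "enthalpy M U" 1]
    by (simp add: matter_op_def q_def [symmetric]) (simp add: dist mult_ac)
  show ?density
    unfolding S z_def zz_def by (simp add: matter_op_def dist mult_ac)
  show ?bulk
    unfolding S z_def zz_def e by (simp add: matter_op_def kq) (simp add: dist mult_ac)
  show ?shear
    unfolding S z_def zz_def by (simp add: matter_op_def) (simp add: dist mult_ac)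
qed

definition cubic_discriminant :: "real \<Rightarrow> real \<Rightarrow> real \<Rightarrow> real" where
  "cubic_discriminant A2 A1 A0 =
     - 27 * (2 * (A2 / 3) ^ 3 - A2 / 3 * A1 + A0) ^ 2 - 4 * (A1 - 3 * (A2 / 3) ^ 2) ^ 3"

end

(*
  In an eigenframe, with z = u.phi and f_1, f_2, f_3 the frame components of the covector, eliminating the
  scalar and shear perturbations leaves a 4 x 4 Schur complement.  Its u-row decouples, because the
  term u w of the momentum equation cancels against the one in C_pi; the rest is the 3 x 3 matrix
  z^2 diag(E + Lambda_a) - (quadratic in f), whose determinant is a cubic in z^2 depending only on
  z^2 and f_a^2.  So in the rest frame the characteristic roots are real and subluminal iff the
  cubic and the quadratic factor have all their roots in [0,1], which the inequalities express.

  What remains is the passage between the rest frame and the coordinate time direction.  Both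
  implications are one statement on a homogeneous polynomial p: if p has only real roots in
  direction tau and vanishes neither at tau nor on the ray xi + r tau (r >= 0), then it has only
  real roots in direction xi.  Here p is the matter determinant times the cometric, and the
  absence of zeros on timelike covectors is (CII).
*)

theory Submission
  imports Defs "HOL-Complex_Analysis.Great_Picard"
begin

text \<open>(CI) asks for roots in \<open>\<phi>$0\<close>, and for a moving fluid the determinant
  is in general neither even nor odd in that variable: only along the fluid's own covector does it
  become a polynomial in z^2. Hence hyperbolicity has to be carried from one direction to the other
  instead of being computed in one of them. The ray condition holds because the sign of the
  rest-frame covector is chosen so that it lies in the same half of the light cone as dx^0; sums of
  the two are then timelike, and timelike covectors are not characteristic. The requirement that
  tau_Pi, tau_pi and all E + Lambda_a be nonzero also comes from (CII). At a covector with no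
  spatial part the determinant is, up to a power of z, a monomial in these quantities, so if one of
  them vanished this timelike covector would be characteristic. Elimination divides by z, tau_Pi and
  tau_pi. For z = 0 or tau_pi = 0 a kernel vector replaces it, and for tau_Pi = 0 a vanishing column
  at purely temporal covectors.\<close>

section \<open>Block determinants\<close>

text \<open>In the Leibniz sum a permutation that moves an index outside \<open>range f\<close>
  picks an off-diagonal zero. The surviving permutations fix that complement pointwise, so they are
  the transports along \<open>f\<close> of the permutations of the smaller index type, with the same
  sign.\<close>

lemma det_diagonal_rows:
  fixes A :: "'a::comm_ring_1^'n^'n" and f :: "'m::finite \<Rightarrow> 'n"
  assumes f: "inj f" and diag: "\<And>i j. i \<notin> range f \<Longrightarrow> j \<noteq> i \<Longrightarrow> A$i$j = 0"
  shows "det A = (\<Prod>i\<in>- range f. A$i$i) * det (\<chi> i j. A$f i$f j)"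
proof -
  let ?t = "\<lambda>p. of_int (sign p) * (\<Prod>i\<in>UNIV. A$i$p i)"
  let ?m = "map_permutation UNIV f"
  have bij: "bij_betw ?m {p. p permutes UNIV} {p. p permutes range f}"
  proof -
    have "bij_betw f UNIV (range f)"
      using f by (simp add: inj_on_imp_bij_betw)
    from bij_betw_permutations [OF this] show ?thesis
      by (rule bij_betw_cong [THEN iffD1, rotated])
        (auto simp: map_permutation_def restrict_id_def fun_eq_iff)
  qed
  have t: "?t (?m p) = (\<Prod>i\<in>- range f. A$i$i) * (of_int (sign p) * (\<Prod>i\<in>UNIV. A$f i$f (p i)))"
    if p: "p permutes UNIV" for p
  proof -
    have "(\<Prod>i\<in>UNIV. A$i$?m p i) = (\<Prod>i\<in>- range f. A$i$?m p i) * (\<Prod>i\<in>range f. A$i$?m p i)"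
      by (subst prod.union_disjoint [symmetric]) (auto simp: Compl_partition2 intro: prod.cong)
    also have "(\<Prod>i\<in>range f. A$i$?m p i) = (\<Prod>i\<in>UNIV. A$f i$f (p i))"
      by (subst prod.reindex [OF f]) (simp add: map_permutation_apply [OF f])
    also have "(\<Prod>i\<in>- range f. A$i$?m p i) = (\<Prod>i\<in>- range f. A$i$i)"
      by (rule prod.cong) (auto simp: map_permutation_def restrict_id_def)
    finally show ?thesis
      using sign_map_permutation [OF f p] by (simp add: mult_ac)
  qed
  have "det A = (\<Sum>p | p permutes range f. ?t p)"
    unfolding det_def
  proof (rule sum.mono_neutral_right)
    show "{p. p permutes range f} \<subseteq> {p. p permutes UNIV}"
      by (auto intro: permutes_subset)
    show "\<forall>p\<in>{p. p permutes UNIV} - {p. p permutes range f}. ?t p = 0"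
    proof
      fix p assume p: "p \<in> {p. p permutes UNIV} - {p. p permutes range f}"
      then obtain i where i: "i \<notin> range f" "p i \<noteq> i"
        using permutes_superset [of p UNIV "range f"] by auto
      then have "A$i$p i = 0"
        using diag by blast
      then show "?t p = 0"
        by (metis UNIV_I finite mult_zero_right prod_zero)
    qed
  qed simp
  also have "\<dots> = (\<Sum>p | p permutes UNIV. ?t (?m p))"
    by (rule sum.reindex_bij_betw [OF bij, symmetric])
  also have "\<dots> = (\<Sum>p | p permutes UNIV. (\<Prod>i\<in>- range f. A$i$i) *
      (of_int (sign p) * (\<Prod>i\<in>UNIV. A$f i$f (p i))))"
    using t by (intro sum.cong) auto
  finally show ?thesis
    by (simp add: det_def sum_distrib_left)
qed

text \<open>Column operations, collected in the unipotent matrix \<open>X\<close>, use the diagonal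
  entries \<open>d\<close> to clear the rest of their rows. They leave the determinant unchanged,
  and the product is of the kind treated by \<open>det_diagonal_rows\<close>; so is the transpose of
  \<open>X\<close>, which gives \<open>det X = 1\<close>.\<close>

lemma det_Schur_complement:
  fixes A :: "'a::field^'n^'n" and f :: "'m::finite \<Rightarrow> 'n" and d :: "'n \<Rightarrow> 'a"
  assumes f: "inj f"
    and diag: "\<And>i j. i \<notin> range f \<Longrightarrow> j \<notin> range f \<Longrightarrow> A$i$j = (if i = j then d i else 0)"
    and nz: "\<And>i. i \<notin> range f \<Longrightarrow> d i \<noteq> 0"
  shows "det A = (\<Prod>i\<in>- range f. d i) *
    det (\<chi> i j. A$f i$f j - (\<Sum>k\<in>- range f. A$f i$k * A$k$f j / d k))"
proof -
  define X :: "'a^'n^'n" where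
    "X = (\<chi> i j. if i = j then 1 else if i \<notin> range f \<and> j \<in> range f then - A$i$j / d i else 0)"
  have X: "det X = 1"
  proof -
    have "det (transpose X) = (\<Prod>i\<in>- range f. 1) * det (mat 1 :: 'a^'m^'m)"
      by (subst det_diagonal_rows [OF f])
        (auto simp: X_def transpose_def mat_def inj_eq [OF f] vec_eq_iff intro!: arg_cong [where f = det])
    then show ?thesis by (simp add: det_transpose)
  qed
  have entry: "(A ** X)$i$j = (\<Sum>k\<in>range f. A$i$k * X$k$j) + (\<Sum>k\<in>- range f. A$i$k * X$k$j)" for i j
    unfolding matrix_matrix_mult_def
    by (simp, subst sum.union_disjoint [symmetric]) (auto simp: Compl_partition intro: sum.cong)
  have AXin: "(A ** X)$i$j = A$i$j - (\<Sum>k\<in>- range f. A$i$k * A$k$j / d k)" if "j \<in> range f" for i j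
  proof -
    have "(\<Sum>k\<in>range f. A$i$k * X$k$j) = (\<Sum>k\<in>range f. if k = j then A$i$k else 0)"
      by (rule sum.cong) (auto simp: X_def)
    moreover have "(\<Sum>k\<in>- range f. A$i$k * X$k$j) = (\<Sum>k\<in>- range f. - (A$i$k * A$k$j / d k))"
      using that by (intro sum.cong) (auto simp: X_def)
    ultimately show ?thesis
      using that by (simp add: entry sum_negf)
  qed
  have AXout: "(A ** X)$i$j = A$i$j" if "j \<notin> range f" for i j
  proof -
    have "(\<Sum>k\<in>range f. A$i$k * X$k$j) = 0"
      using that by (intro sum.neutral) (auto simp: X_def)
    moreover have "(\<Sum>k\<in>- range f. A$i$k * X$k$j) = (\<Sum>k\<in>- range f. if k = j then A$i$k else 0)"
      using that by (intro sum.cong) (auto simp: X_def)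
    ultimately show ?thesis
      using that by (simp add: entry)
  qed
  have zero: "(A ** X)$i$j = 0" if "i \<notin> range f" "j \<noteq> i" for i j
  proof (cases "j \<in> range f")
    case True
    have "(\<Sum>k\<in>- range f. A$i$k * A$k$j / d k) = (\<Sum>k\<in>- range f. if k = i then A$k$j else 0)"
      using that diag nz by (intro sum.cong) auto
    then show ?thesis
      using that True by (simp add: AXin)
  next
    case False
    then show ?thesis using that diag by (simp add: AXout)
  qed
  have "det A = det (A ** X)"
    by (simp add: det_mul X)
  also have "\<dots> = (\<Prod>i\<in>- range f. (A ** X)$i$i) * det (\<chi> i j. (A ** X)$f i$f j)"
    by (rule det_diagonal_rows [OF f zero])
  also have "(\<Prod>i\<in>- range f. (A ** X)$i$i) = (\<Prod>i\<in>- range f. d i)"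
    using diag by (intro prod.cong) (auto simp: AXout)
  finally show ?thesis
    by (simp add: AXin)
qed

section \<open>Real-rooted polynomials in two directions\<close>

text \<open>Supplies the locally uniform convergence for Hurwitz: on the compact set
  \<open>cball l 1 \<times> K\<close> joint continuity is uniform.\<close>

lemma uniform_limit_of_continuous_parameter:
  fixes F :: "real \<Rightarrow> complex \<Rightarrow> complex"
  assumes "continuous_on UNIV (\<lambda>(l, t). F l t)" and "compact K"
    and lim: "x \<longlonglongrightarrow> l"
  shows "uniform_limit K (\<lambda>n. F (x n)) (F l) sequentially"
proof (rule uniform_limitI)
  fix e :: real assume "0 < e"
  have "uniformly_continuous_on (cball l 1 \<times> K) (\<lambda>(l, t). F l t)"
    using assms by (intro compact_uniformly_continuous compact_Times) (auto intro: continuous_on_subset)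
  then obtain d where "0 < d" and
    d: "\<And>a b. a \<in> cball l 1 \<times> K \<Longrightarrow> b \<in> cball l 1 \<times> K \<Longrightarrow> dist b a < d
        \<Longrightarrow> dist (case_prod F b) (case_prod F a) < e"
    using \<open>0 < e\<close> unfolding uniformly_continuous_on_def by metis
  have "\<forall>\<^sub>F n in sequentially. dist (x n) l < min d 1"
    using lim \<open>0 < d\<close> by (intro tendstoD) auto
  then show "\<forall>\<^sub>F n in sequentially. \<forall>t\<in>K. dist (F (x n) t) (F l t) < e"
  proof (eventually_elim, intro ballI)
    fix n t assume "dist (x n) l < min d 1" "t \<in> K"
    then show "dist (F (x n) t) (F l t) < e"
      using d [of "(l, t)" "(x n, t)"] by (auto simp: dist_Pair_Pair dist_commute)
  qed
qed

context
  fixes p :: "complex^'n \<Rightarrow> complex" and \<xi> \<tau> :: "complex^'n" and N :: nat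
  assumes cont: "continuous_on UNIV p"
    and hol: "\<And>a b. (\<lambda>t. p (a + t *s b)) holomorphic_on UNIV"
    and hom: "\<And>c x. p (c *s x) = c ^ N * p x"
    and real: "\<And>\<eta> s. (\<forall>i. \<eta>$i \<in> \<real>) \<Longrightarrow> p (\<eta> + s *s \<tau>) = 0 \<Longrightarrow> s \<in> \<real>"
    and \<xi>: "\<forall>i. \<xi>$i \<in> \<real>"
    and nz: "p \<tau> \<noteq> 0" "\<And>r. 0 \<le> r \<Longrightarrow> p (\<xi> + of_real r *s \<tau>) \<noteq> 0"
begin

text \<open>This excludes roots at infinity: when a root of
  \<open>\<eta> + t \<xi> + i c \<tau>\<close> is rescaled, \<open>\<eta>\<close> drops out in the
  limit and the form treated here remains. Dividing by t leaves a root \<open>s = i c / t\<close> in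
  direction \<open>\<tau>\<close> at \<open>\<xi>\<close>, which is real by hyperbolicity and
  negative by the ray condition; a negative multiple of t cannot equal i c in the closed upper half
  plane unless both vanish.\<close>

lemma no_root_in_wedge:
  assumes "0 \<le> Im t" "0 \<le> c" "p (t *s \<xi> + (\<i> * of_real c) *s \<tau>) = 0"
  shows "t = 0 \<and> c = 0"
proof (cases "t = 0")
  case True
  then have "(\<i> * of_real c) ^ N * p \<tau> = 0"
    using assms(3) by (simp add: hom)
  then show ?thesis
    using nz(1) True by simp
next
  case False
  define s where "s = \<i> * of_real c / t"
  have "t *s (\<xi> + s *s \<tau>) = t *s \<xi> + (\<i> * of_real c) *s \<tau>"
    using False by (simp add: vec_eq_iff s_def field_simps)
  then have s: "p (\<xi> + s *s \<tau>) = 0"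
    using assms(3) False hom [of t "\<xi> + s *s \<tau>"] by (metis mult_eq_0_iff power_not_zero)
  then obtain r where r: "s = of_real r"
    using real \<xi> by (metis Reals_cases)
  then have "r < 0"
    using nz(2) [of r] s by (cases "0 \<le> r") auto
  have "of_real r * t = \<i> * of_real c"
    using False r s_def by (simp add: field_simps)
  then have "r * Im t = c" "r * Re t = 0"
    by (auto simp: complex_eq_iff)
  then have "Im t = 0"
    using \<open>r < 0\<close> assms(1,2) by (smt (verit) mult_neg_pos)
  then show ?thesis
    using False \<open>r * Re t = 0\<close> \<open>r < 0\<close> by (auto simp: complex_eq_iff)
qed

text \<open>If there were such a root, follow it along \<open>\<eta> + t \<xi> + i l \<tau>\<close>: the set of pairs
  \<open>(l, t)\<close> of zeros with \<open>l \<ge> 0\<close>, \<open>Im t \<ge> 0\<close> is compact, and at a pair with maximal \<open>l\<close>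
  the root \<open>t\<close> cannot disappear for slightly larger \<open>l\<close>, by Hurwitz.\<close>

lemma no_root_upper_half_plane:
  assumes \<eta>: "\<forall>i. \<eta>$i \<in> \<real>" and "0 < Im t0"
  shows "p (\<eta> + t0 *s \<xi>) \<noteq> 0"
proof
  assume root: "p (\<eta> + t0 *s \<xi>) = 0"
  define F where "F l t = p ((\<eta> + (\<i> * of_real l) *s \<tau>) + t *s \<xi>)" for l t
  define Z where "Z = {(l, t). 0 \<le> l \<and> 0 \<le> Im t \<and> F l t = 0}"
  have contF: "continuous_on UNIV (\<lambda>(l, t). F l t)"
    unfolding F_def case_prod_beta vector_scalar_mult_def
    by (intro continuous_on_compose2 [OF cont] continuous_intros) auto
  \<comment> \<open>Unbounded zeros are divided by their size \<open>R n\<close>. By homogeneity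
    they remain zeros, now with \<open>\<eta>\<close> scaled by \<open>1 / R n\<close>; a limit
    point on the compact set \<open>Q\<close> is a nonzero pair excluded by
    \<open>no_root_in_wedge\<close>.\<close>
  have bdd: "bounded Z"
  proof (rule ccontr)
    assume unb: "\<not> bounded Z"
    have "\<exists>l t. (l, t) \<in> Z \<and> real (Suc n) \<le> l + norm t" for n
    proof (rule ccontr)
      assume "\<not> ?thesis"
      then have *: "l + norm t \<le> Suc n" if "(l, t) \<in> Z" for l t
        using that by fastforce
      have "norm x \<le> Suc n" if "x \<in> Z" for x
      proof -
        obtain l t where x: "x = (l, t)" by force
        have "norm x \<le> norm l + norm t"
          unfolding x by (rule norm_Pair_le)
        then show ?thesis
          using * [of l t] that x by (auto simp: Z_def)
      qed
      then show False
        using unb unfolding bounded_iff by blast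
    qed
    then obtain l t where Z: "\<And>n. (l n, t n) \<in> Z" and large: "\<And>n. real (Suc n) \<le> l n + norm (t n)"
      by metis
    define R where "R n = l n + norm (t n)" for n
    have R: "0 < R n" "real (Suc n) \<le> R n" for n
      using large [of n] unfolding R_def by linarith+
    define Q :: "(real \<times> complex) set" where "Q = {(c, t). 0 \<le> c \<and> 0 \<le> Im t \<and> c + norm t = 1}"
    have "compact Q"
      unfolding compact_eq_bounded_closed
    proof
      have "norm x \<le> 1" if "x \<in> Q" for x
        using that norm_Pair_le [of "fst x" "snd x"] by (auto simp: Q_def)
      then show "bounded Q"
        unfolding bounded_iff by blast
      show "closed Q"
        unfolding Q_def case_prod_beta
        by (intro closed_Collect_conj closed_Collect_le closed_Collect_eq continuous_intros)
    qed
    define q where "q n = (l n / R n, t n / of_real (R n))" for n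
    have "l n / R n + norm (t n) / R n = 1" for n
      using R(1) [of n] by (simp add: add_divide_distrib [symmetric] R_def)
    then have "q n \<in> Q" for n
      using Z [of n] R(1) [of n] by (auto simp: q_def Q_def Z_def norm_divide)
    then obtain c b r where Q: "(c, b) \<in> Q" and "strict_mono r" and lim: "(q \<circ> r) \<longlonglongrightarrow> (c, b)"
      using \<open>compact Q\<close> unfolding compact_def by (metis surj_pair)
    define h where "h n = p (of_real (1 / R n) *s \<eta> + (\<i> * of_real (fst (q n))) *s \<tau> + snd (q n) *s \<xi>)" for n
    have "h n = 0" for n
    proof -
      have "of_real (1 / R n) *s \<eta> + (\<i> * of_real (fst (q n))) *s \<tau> + snd (q n) *s \<xi>
          = of_real (1 / R n) *s ((\<eta> + (\<i> * of_real (l n)) *s \<tau>) + t n *s \<xi>)"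
        using R(1) [of n] by (simp add: q_def vec_eq_iff field_simps)
      then have "h n = of_real (1 / R n) ^ N * F (l n) (t n)"
        unfolding h_def F_def by (simp only: hom)
      then show ?thesis
        using Z [of n] by (simp add: Z_def)
    qed
    moreover have "(\<lambda>n. h (r n)) \<longlonglongrightarrow> p (of_real 0 *s \<eta> + (\<i> * of_real c) *s \<tau> + b *s \<xi>)"
      unfolding h_def vector_scalar_mult_def
    proof (rule continuous_on_tendsto_compose [OF cont])
      have R0: "(\<lambda>n. 1 / R n) \<longlonglongrightarrow> 0"
      proof (rule tendsto_sandwich)
        show "\<forall>\<^sub>F n in sequentially. 0 \<le> 1 / R n"
          using R(1) by (simp add: less_imp_le)
        show "\<forall>\<^sub>F n in sequentially. 1 / R n \<le> inverse (real (Suc n))"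
          using R by (simp add: frac_le inverse_eq_divide)
        show "(\<lambda>n. inverse (real (Suc n))) \<longlonglongrightarrow> 0"
          by (rule LIMSEQ_inverse_real_of_nat)
      qed simp
      have R1: "(\<lambda>n. 1 / R (r n)) \<longlonglongrightarrow> 0"
        using LIMSEQ_subseq_LIMSEQ [OF R0 \<open>strict_mono r\<close>] by (simp add: o_def)
      have "(\<lambda>n. fst (q (r n))) \<longlonglongrightarrow> c" "(\<lambda>n. snd (q (r n))) \<longlonglongrightarrow> b"
        using tendsto_fst [OF lim] tendsto_snd [OF lim] by (simp_all add: o_def)
      with R1 show "(\<lambda>n. (\<chi> i. of_real (1 / R (r n)) * \<eta>$i) + (\<chi> i. \<i> * of_real (fst (q (r n))) * \<tau>$i)
            + (\<chi> i. snd (q (r n)) * \<xi>$i))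
          \<longlonglongrightarrow> (\<chi> i. of_real 0 * \<eta>$i) + (\<chi> i. \<i> * of_real c * \<tau>$i) + (\<chi> i. b * \<xi>$i)"
        by (intro tendsto_intros)
    qed auto
    ultimately have "p (b *s \<xi> + (\<i> * of_real c) *s \<tau>) = 0"
      by (simp add: LIMSEQ_const_iff add.commute)
    with Q no_root_in_wedge [of b c] show False
      by (auto simp: Q_def)
  qed
  have "compact Z"
    unfolding compact_eq_bounded_closed
  proof (rule conjI [OF bdd])
    have "continuous_on UNIV (\<lambda>x. F (fst x) (snd x))"
      using contF by (simp add: case_prod_beta)
    then show "closed Z"
      unfolding Z_def case_prod_beta
      by (intro closed_Collect_conj closed_Collect_le closed_Collect_eq continuous_intros)
  qed
  have t0: "(0, t0) \<in> Z"
    using assms root by (simp add: Z_def F_def)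
  obtain l' t' where Z': "(l', t') \<in> Z" and max: "\<And>l t. (l, t) \<in> Z \<Longrightarrow> l \<le> l'"
    using continuous_attains_sup [OF \<open>compact Z\<close>, of fst] t0 continuous_on_fst [OF continuous_on_id]
    by (metis empty_iff fst_conv surj_pair)
  \<comment> \<open>Hurwitz needs a root in the open half plane. At \<open>l' = 0\<close> the
    assumed root \<open>t0\<close> serves. For \<open>l' > 0\<close> a root on the real axis would
    give the non-real root \<open>i l'\<close> in direction \<open>\<tau>\<close> at a real
    point.\<close>
  obtain t1 where t1: "(l', t1) \<in> Z" "0 < Im t1"
  proof (cases "l' = 0")
    case True
    then show ?thesis using that t0 assms by blast
  next
    case False
    have "Im t' \<noteq> 0"
    proof
      assume "Im t' = 0"
      then have "t' \<in> \<real>"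
        by (simp add: complex_is_Real_iff)
      then have "\<forall>i. (\<eta> + t' *s \<xi>)$i \<in> \<real>"
        using \<eta> \<xi> by simp
      moreover have "p ((\<eta> + t' *s \<xi>) + (\<i> * of_real l') *s \<tau>) = 0"
        using Z' by (simp add: Z_def F_def ac_simps)
      ultimately have "\<i> * of_real l' \<in> \<real>"
        using real by blast
      then show False
        using False by (simp add: complex_is_Real_iff)
    qed
    with Z' that show ?thesis
      by (auto simp: Z_def)
  qed
  define S where "S = {t. 0 < Im t}"
  have holF: "F l holomorphic_on S" for l
    unfolding F_def by (rule holomorphic_on_subset [OF hol]) simp
  have "F l' t1 \<noteq> 0"
  \<comment> \<open>By maximality of \<open>l'\<close> the approximating functions, with parameter
    slightly above \<open>l'\<close>, have no zero in the half plane, and the limit inherits this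
    unless it is constant.\<close>
  proof (rule Hurwitz_no_zeros [where S = S and g = "F l'" and \<F> = "\<lambda>n. F (l' + inverse (real (Suc n)))"])
    show "open S" "connected S"
      unfolding S_def by (simp_all add: open_halfspace_Im_gt convex_connected convex_halfspace_Im_gt)
    have "(\<lambda>n. l' + inverse (real (Suc n))) \<longlonglongrightarrow> l' + 0"
      by (intro tendsto_intros LIMSEQ_inverse_real_of_nat)
    then have lim: "(\<lambda>n. l' + inverse (real (Suc n))) \<longlonglongrightarrow> l'"
      by simp
    show "uniform_limit K (\<lambda>n. F (l' + inverse (real (Suc n)))) (F l') sequentially" if "compact K" "K \<subseteq> S" for K
      by (rule uniform_limit_of_continuous_parameter [OF contF that(1) lim])
    show "F (l' + inverse (real (Suc n))) z \<noteq> 0" if "z \<in> S" for n z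
    proof
      assume "F (l' + inverse (real (Suc n))) z = 0"
      then have "(l' + inverse (real (Suc n)), z) \<in> Z"
        using that Z' by (simp add: Z_def S_def)
      from max [OF this] show False
        by (simp del: of_nat_Suc)
    qed
    \<comment> \<open>A constant would be zero because of \<open>t1\<close>, and then the whole
      positive imaginary axis would lie in the bounded set \<open>Z\<close>.\<close>
    show "\<not> F l' constant_on S"
    proof
      assume "F l' constant_on S"
      then have "F l' z = 0" if "z \<in> S" for z
        using that t1 unfolding constant_on_def by (metis (mono_tags, lifting) S_def Z_def case_prodD mem_Collect_eq)
      then have sub: "(\<lambda>y. (l', Complex 0 y)) ` {0<..} \<subseteq> Z"
        using Z' by (auto simp: S_def Z_def)
      obtain B where B: "\<And>x. x \<in> Z \<Longrightarrow> norm x \<le> B"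
        using bdd unfolding bounded_iff by blast
      have "norm (l', Complex 0 (\<bar>B\<bar> + 1)) \<le> B"
        by (rule B, rule subsetD [OF sub]) simp
      moreover have "norm (Complex 0 (\<bar>B\<bar> + 1)) \<le> norm (l', Complex 0 (\<bar>B\<bar> + 1))"
        by (metis norm_snd_le snd_conv)
      moreover have "norm (Complex 0 (\<bar>B\<bar> + 1)) = \<bar>B\<bar> + 1"
        by (simp add: complex_norm)
      ultimately show False by linarith
    qed
    show "t1 \<in> S" using t1 by (simp add: S_def)
  qed (rule holF)+
  with t1 show False
    by (simp add: Z_def)
qed

lemma hyperbolic_direction_change:
  assumes \<eta>: "\<forall>i. \<eta>$i \<in> \<real>" and root: "p (\<eta> + t *s \<xi>) = 0"
  shows "t \<in> \<real>"
proof (rule ccontr)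
  assume "t \<notin> \<real>"
  then consider "0 < Im t" | "0 < Im (- t)"
    by (metis complex_is_Real_iff linorder_neqE neg_0_less_iff_less uminus_complex.sel(2))
  then show False
  proof cases
    case 1
    with no_root_upper_half_plane [OF \<eta>] root show False by blast
  next
    case 2
    \<comment> \<open>Homogeneity with factor -1 turns a root in the lower half plane into one in
      the upper half plane, at the real point \<open>- \<eta>\<close>.\<close>
    have "- \<eta> + (- t) *s \<xi> = (-1) *s (\<eta> + t *s \<xi>)"
      by (simp add: vec_eq_iff)
    then have "p (- \<eta> + (- t) *s \<xi>) = (-1) ^ N * p (\<eta> + t *s \<xi>)"
      by (simp only: hom)
    then have "p (- \<eta> + (- t) *s \<xi>) = 0"
      using root by simp
    moreover have "\<forall>i. (- \<eta>)$i \<in> \<real>"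
      using \<eta> by simp
    ultimately show False
      using no_root_upper_half_plane [of "- \<eta>" "- t"] 2 by blast
  qed
qed

end

section \<open>The matter determinant in an eigenframe\<close>

lemma UNIV_4_zero: "UNIV = {0, 1, 2, 3::4}"
proof -
  have "(4::4) = 0" by simp
  then show ?thesis
    unfolding UNIV_4 by (metis insert_commute)
qed

lemma forall_4_zero: "(\<forall>a::4. P a) \<longleftrightarrow> P 0 \<and> P 1 \<and> P 2 \<and> P 3"
proof
  assume "P 0 \<and> P 1 \<and> P 2 \<and> P 3"
  then have "\<forall>a\<in>{0, 1, 2, 3}. P a" by simp
  then show "\<forall>a. P a" by (simp only: UNIV_4_zero [symmetric]) simp
qed simp

lemma sum_UNIV_4: "sum h (UNIV :: 4 set) = h 0 + (\<Sum>a\<in>{1, 2, 3}. h a)"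
  unfolding UNIV_4_zero by simp

lemma not_zero_4: "a \<noteq> 0 \<longleftrightarrow> a \<in> {1, 2, 3 :: 4}"
proof -
  have "a \<in> {0, 1, 2, 3}"
    unfolding UNIV_4_zero [symmetric] by simp
  then show ?thesis by auto
qed

lemma Compl_range_Velocity:
  "- range Velocity = {Energy, Density, Bulk} \<union> range (\<lambda>(\<mu>, \<nu>). Shear \<mu> \<nu>)"
  using UNIV_matter_var by auto

lemma sum_Compl_range_Velocity:
  "(\<Sum>k\<in>- range Velocity. h k) = h Energy + h Density + h Bulk + (\<Sum>\<mu>\<in>UNIV. \<Sum>\<nu>\<in>UNIV. h (Shear \<mu> \<nu>))"
proof -
  have "(\<Sum>k\<in>range (\<lambda>(\<mu>, \<nu>). Shear \<mu> \<nu>). h k) = (\<Sum>\<mu>\<in>UNIV. \<Sum>\<nu>\<in>UNIV. h (Shear \<mu> \<nu>))"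
    by (subst sum.reindex) (simp_all add: inj_def sum.cartesian_product case_prod_beta)
  then show ?thesis
    unfolding Compl_range_Velocity
    by (subst sum.union_disjoint) (auto simp: add.assoc)
qed

lemma prod_Compl_range_Velocity:
  "(\<Prod>k\<in>- range Velocity. h k) = h Energy * h Density * h Bulk * (\<Prod>\<mu>\<in>UNIV. \<Prod>\<nu>\<in>UNIV. h (Shear \<mu> \<nu>))"
proof -
  have "(\<Prod>k\<in>range (\<lambda>(\<mu>, \<nu>). Shear \<mu> \<nu>). h k) = (\<Prod>\<mu>\<in>UNIV. \<Prod>\<nu>\<in>UNIV. h (Shear \<mu> \<nu>))"
    by (subst prod.reindex) (simp_all add: inj_def prod.cartesian_product case_prod_beta)
  then show ?thesis
    unfolding Compl_range_Velocity
    by (subst prod.union_disjoint) (auto simp: mult.assoc)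
qed

section \<open>Metric, projector and shear in an eigenframe\<close>

locale fluid_frame =
  fixes g :: "real^4^4" and M :: fluid_model and U :: "real^matter_var"
    and e :: "4 \<Rightarrow> real^4" and \<Lambda> :: "4 \<Rightarrow> real"
  assumes frame: "eigenframe g U e \<Lambda>"
begin

abbreviation "E \<equiv> enthalpy M U"
abbreviation "tPi \<equiv> coef g M U tau_Pi"
abbreviation "tpi \<equiv> coef g M U tau_pi"
abbreviation "T \<equiv> coef g M U tau_pipi"

definition visc :: real where
  "visc = coef g M U eta + 1/2 * coef g M U lambda_piPi * U$Bulk"

definition frame_matrix :: "real^4^4" where
  "frame_matrix = (\<chi> \<mu> a. e a $ \<mu>)"

text \<open>Evaluation of the covector on the frame: component 0 is z and the spatial components are
  the v_a. The type is polymorphic because (CI) needs complex covectors and (CII) real ones.\<close>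

definition fcomp :: "('a::real_field)^4 \<Rightarrow> 4 \<Rightarrow> 'a" where
  "fcomp \<phi> a = (\<Sum>\<mu>\<in>UNIV. of_real (e a $ \<mu>) * \<phi>$\<mu>)"

lemma e_0: "e 0 = vel U" and Lambda_0: "\<Lambda> 0 = 0"
  and ortho: "gprod g (e a) (e b) = minkowski$a$b"
  and eigen: "shear_mixed g U *v e a = \<Lambda> a *\<^sub>R e a"
  using frame by (auto simp: eigenframe_def)

lemma frame_matrix_metric: "transpose frame_matrix ** g ** frame_matrix = minkowski"
proof -
  have "(transpose frame_matrix ** g ** frame_matrix)$a$b = gprod g (e a) (e b)" for a b
    unfolding gprod_def frame_matrix_def matrix_matrix_mult_def transpose_def
    by (simp add: sum_distrib_right sum_distrib_left, subst sum.swap) (simp add: mult_ac)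
  then show ?thesis
    by (simp add: vec_eq_iff ortho)
qed

lemma minkowski_squared: "minkowski ** minkowski = mat 1"
  by (simp add: vec_eq_iff forall_4_zero sum_UNIV_4 matrix_matrix_mult_def minkowski_def mat_def)

lemma frame_matrix_left_inverse: "minkowski ** transpose frame_matrix ** g ** frame_matrix = mat 1"
  using frame_matrix_metric minkowski_squared by (metis matrix_mul_assoc)

lemma frame_matrix_right_inverse: "frame_matrix ** (minkowski ** transpose frame_matrix ** g) = mat 1"
  using frame_matrix_left_inverse by (simp only: matrix_left_right_inverse)

lemma det_Fr: "det frame_matrix \<noteq> 0"
  using frame_matrix_left_inverse by (metis det_I det_mul mult_zero_right zero_neq_one)

lemma matrix_inv_g: "matrix_inv g = frame_matrix ** minkowski ** transpose frame_matrix"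
proof -
  let ?h = "frame_matrix ** minkowski ** transpose frame_matrix"
  have l: "?h ** g = mat 1"
    using frame_matrix_right_inverse by (simp add: matrix_mul_assoc)
  then have r: "g ** ?h = mat 1"
    by (simp only: matrix_left_right_inverse)
  have "\<exists>A'. g ** A' = mat 1 \<and> A' ** g = mat 1"
    using l r by blast
  then have "matrix_inv g ** g = mat 1"
    unfolding matrix_inv_def by (rule someI2_ex) blast
  then have "(matrix_inv g ** g) ** ?h = ?h"
    by simp
  moreover have "(matrix_inv g ** g) ** ?h = matrix_inv g ** (g ** ?h)"
    by (rule matrix_mul_assoc [symmetric])
  ultimately show ?thesis
    using r by simp
qed

lemma matrix_inv_g_entry:
  "matrix_inv g $\<mu>$\<nu> = (\<Sum>a\<in>{1, 2, 3}. e a$\<mu> * e a$\<nu>) - e 0$\<mu> * e 0$\<nu>"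
  unfolding matrix_inv_g
  by (simp add: matrix_matrix_mult_def frame_matrix_def transpose_def minkowski_def sum_UNIV_4)

lemma proj_entry: "proj g U $\<mu>$\<nu> = (\<Sum>a\<in>{1, 2, 3}. e a$\<mu> * e a$\<nu>)"
  unfolding proj_def by (simp add: matrix_inv_g_entry e_0)

lemma shear_mixed_contract: "(\<Sum>\<nu>\<in>UNIV. shear_mixed g U $\<mu>$\<nu> * e b$\<nu>) = \<Lambda> b * e b$\<mu>"
  using eigen [of b] by (simp add: vec_eq_iff matrix_vector_mult_def)

text \<open>Raising the index of the mixed shear with the inverse metric
  \<open>F \<eta> F\<^sup>T\<close> of the frame matrix turns the eigenvector equations into a
  spectral decomposition. The e_0 term disappears because its eigenvalue is 0.\<close>

lemma shear_entry: "shear U $\<mu>$\<nu> = (\<Sum>a\<in>{1, 2, 3}. \<Lambda> a * e a$\<mu> * e a$\<nu>)"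
proof -
  have "(frame_matrix ** minkowski ** transpose frame_matrix) ** g = mat 1"
    using frame_matrix_right_inverse by (simp add: matrix_mul_assoc)
  then have "g ** (frame_matrix ** minkowski ** transpose frame_matrix) = mat 1"
    by (simp only: matrix_left_right_inverse)
  then have "shear U = shear U ** (g ** (frame_matrix ** minkowski ** transpose frame_matrix))"
    by simp
  also have "\<dots> = shear_mixed g U ** (frame_matrix ** minkowski ** transpose frame_matrix)"
    unfolding shear_mixed_def by (rule matrix_mul_assoc)
  also have "\<dots> = (shear_mixed g U ** frame_matrix) ** (minkowski ** transpose frame_matrix)"
    by (simp add: matrix_mul_assoc)
  also have "shear_mixed g U ** frame_matrix = (\<chi> \<mu> a. \<Lambda> a * e a$\<mu>)"
    by (simp add: vec_eq_iff matrix_matrix_mult_def frame_matrix_def shear_mixed_contract)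
  finally show ?thesis
    by (simp add: matrix_matrix_mult_def transpose_def minkowski_def frame_matrix_def sum_UNIV_4 Lambda_0)
qed

lemma shear_sym: "shear U $\<mu>$\<nu> = shear U $\<nu>$\<mu>"
  by (simp add: shear_entry mult_ac)

lemma proj_sym: "proj g U $\<mu>$\<nu> = proj g U $\<nu>$\<mu>"
  by (simp add: proj_entry mult_ac)

lemma proj_mixed_contract:
  "(\<Sum>\<nu>\<in>UNIV. proj_mixed g U $\<mu>$\<nu> * e b$\<nu>) = (if b = 0 then 0 else e b$\<mu>)"
proof -
  define G where "G \<alpha> = (\<Sum>\<nu>\<in>UNIV. g$\<alpha>$\<nu> * e b$\<nu>)" for \<alpha>
  have G: "(\<Sum>\<alpha>\<in>UNIV. e a$\<alpha> * G \<alpha>) = minkowski$a$b" for a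
    unfolding ortho [symmetric] gprod_def G_def by (simp add: sum_distrib_left mult_ac)
  have "(\<Sum>\<nu>\<in>UNIV. proj_mixed g U $\<mu>$\<nu> * e b$\<nu>) = (\<Sum>\<alpha>\<in>UNIV. proj g U $\<mu>$\<alpha> * G \<alpha>)"
    unfolding proj_mixed_def matrix_matrix_mult_def G_def
    by (simp add: sum_distrib_right sum_distrib_left, subst sum.swap) (simp add: mult_ac)
  also have "\<dots> = (\<Sum>a\<in>{1, 2, 3}. e a$\<mu> * (\<Sum>\<alpha>\<in>UNIV. e a$\<alpha> * G \<alpha>))"
    unfolding proj_entry
    by (simp add: sum.distrib sum_distrib_left sum_distrib_right distrib_left distrib_right mult_ac)
  finally have "(\<Sum>\<nu>\<in>UNIV. proj_mixed g U $\<mu>$\<nu> * e b$\<nu>) = (\<Sum>a\<in>{1, 2, 3}. e a$\<mu> * minkowski$a$b)"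
    by (simp only: G)
  then show ?thesis
    using not_zero_4 [of b] by (auto simp: minkowski_def)
qed

lemma vel_entry: "vel U $\<mu> = e 0$\<mu>"
  by (simp add: e_0)

text \<open>With \<open>wproj\<close> and \<open>wlow\<close> below, these are v^mu, w^mu and w_nu
  of the symbol, in a form that also makes sense for complex covectors.\<close>

definition vproj :: "('a::real_field)^4 \<Rightarrow> 4 \<Rightarrow> 'a" where
  "vproj \<phi> \<mu> = (\<Sum>a\<in>{1, 2, 3}. of_real (e a$\<mu>) * fcomp \<phi> a)"

definition wproj :: "('a::real_field)^4 \<Rightarrow> 4 \<Rightarrow> 'a" where
  "wproj \<phi> \<mu> = (\<Sum>a\<in>{1, 2, 3}. of_real (\<Lambda> a * e a$\<mu>) * fcomp \<phi> a)"

definition wlow :: "('a::real_field)^4 \<Rightarrow> 4 \<Rightarrow> 'a" where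
  "wlow \<phi> \<nu> = (\<Sum>\<alpha>\<in>UNIV. of_real (shear_mixed g U $\<alpha>$\<nu>) * \<phi>$\<alpha>)"

definition C_contr :: "('a::real_field)^4 \<Rightarrow> 4 \<Rightarrow> 4 \<Rightarrow> 4 \<Rightarrow> 'a" where
  "C_contr \<phi> \<mu> \<beta> \<nu> = (\<Sum>\<alpha>\<in>UNIV. of_real (C_shear g M U \<mu> \<beta> \<alpha> \<nu>) * \<phi>$\<alpha>)"

lemma vproj_eq: "(\<Sum>\<alpha>\<in>UNIV. of_real (proj g U $\<mu>$\<alpha>) * \<phi>$\<alpha>) = vproj \<phi> \<mu>"
  unfolding vproj_def fcomp_def proj_entry
  by (simp add: sum.distrib sum_distrib_left distrib_right distrib_left mult_ac)

lemma wproj_eq: "(\<Sum>\<alpha>\<in>UNIV. of_real (shear U $\<mu>$\<alpha>) * \<phi>$\<alpha>) = wproj \<phi> \<mu>"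
  unfolding wproj_def fcomp_def shear_entry
  by (simp add: sum.distrib sum_distrib_left distrib_right distrib_left mult_ac)

lemma shear_lower: "(\<Sum>\<beta>\<in>UNIV. shear U $\<beta>$\<alpha> * g$\<beta>$\<nu>) = shear_mixed g U $\<alpha>$\<nu>"
  unfolding shear_mixed_def matrix_matrix_mult_def by (simp add: shear_sym [of _ \<alpha>])

text \<open>On the 19 unknowns other than the velocity the symbol is diagonal with these entries.
  The value at \<open>Velocity\<close> is a filler and is never read.\<close>

fun diag_coef :: "('a::real_field)^4 \<Rightarrow> matter_var \<Rightarrow> 'a" where
  "diag_coef \<phi> (Velocity \<mu>) = 1"
| "diag_coef \<phi> Energy = fcomp \<phi> 0"
| "diag_coef \<phi> Density = fcomp \<phi> 0"
| "diag_coef \<phi> Bulk = of_real tPi * fcomp \<phi> 0"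
| "diag_coef \<phi> (Shear \<mu> \<nu>) = of_real tpi * fcomp \<phi> 0"

section \<open>Entries of the matter symbol\<close>

abbreviation "symbol \<equiv> matter_symbol g M U"

lemma symbol_entry:
  "symbol \<phi> $ r $ c = (\<Sum>\<alpha>\<in>UNIV. of_real (matter_op g M U \<alpha> (axis c 1) $ r) * \<phi>$\<alpha>)"
  by (simp add: matter_symbol_def A_M_def matrix_def)

lemma symbol_velocity:
  "symbol \<phi> $ Velocity \<mu> $ Velocity \<nu> =
     (if \<mu> = \<nu> then of_real E * fcomp \<phi> 0 else 0) - of_real (e 0$\<mu>) * wlow \<phi> \<nu>"
  "symbol \<phi> $ Velocity \<mu> $ Energy = of_real (P_eps M U) * vproj \<phi> \<mu>"
  "symbol \<phi> $ Velocity \<mu> $ Density = of_real (P_n M U) * vproj \<phi> \<mu>"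
  "symbol \<phi> $ Velocity \<mu> $ Bulk = vproj \<phi> \<mu>"
  "symbol \<phi> $ Velocity \<mu> $ Shear \<kappa> \<beta> = (if \<mu> = \<kappa> then \<phi>$\<beta> else 0)"
proof -
  show "symbol \<phi> $ Velocity \<mu> $ Velocity \<nu> =
     (if \<mu> = \<nu> then of_real E * fcomp \<phi> 0 else 0) - of_real (e 0$\<mu>) * wlow \<phi> \<nu>"
    unfolding symbol_entry fcomp_def wlow_def
    by (cases "\<mu> = \<nu>")
      (simp_all add: matter_op_def axis_def vel_entry shear_lower if_distrib [where f = "\<lambda>x. _ * x"]
        sum_distrib_left sum_subtractf left_diff_distrib sum_negf mult.assoc cong: if_cong)
  show "symbol \<phi> $ Velocity \<mu> $ Energy = of_real (P_eps M U) * vproj \<phi> \<mu>"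
    "symbol \<phi> $ Velocity \<mu> $ Density = of_real (P_n M U) * vproj \<phi> \<mu>"
    "symbol \<phi> $ Velocity \<mu> $ Bulk = vproj \<phi> \<mu>"
    unfolding symbol_entry vproj_eq [symmetric]
    by (simp_all add: matter_op_def axis_def sum_distrib_left mult_ac)
  show "symbol \<phi> $ Velocity \<mu> $ Shear \<kappa> \<beta> = (if \<mu> = \<kappa> then \<phi>$\<beta> else 0)"
    unfolding symbol_entry
    by (simp add: matter_op_def axis_def if_distrib [where f = "\<lambda>x. of_real x * _"]  cong: if_cong)
qed

lemma symbol_coupling:
  "symbol \<phi> $ Energy $ Velocity \<nu> = of_real E * \<phi>$\<nu> + wlow \<phi> \<nu>"
  "symbol \<phi> $ Density $ Velocity \<nu> = of_real (U$Density) * \<phi>$\<nu>"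
  "symbol \<phi> $ Bulk $ Velocity \<nu> = of_real (coef g M U zeta + coef g M U delta_PiPi * U$Bulk) * \<phi>$\<nu>
     + of_real (coef g M U lambda_Pipi) * wlow \<phi> \<nu>"
  "symbol \<phi> $ Shear \<mu> \<beta> $ Velocity \<nu> = C_contr \<phi> \<mu> \<beta> \<nu>"
  unfolding symbol_entry wlow_def C_contr_def
  by (simp_all add: matter_op_def axis_def kron_def if_distrib [where f = "\<lambda>x. _ * x"]
      if_distrib [where f = of_real] if_distrib [where f = "\<lambda>x. x * _"] distrib_right sum.distrib
      sum_distrib_left mult.assoc cong: if_cong)

lemma symbol_diagonal:
  assumes "i \<notin> range Velocity" "j \<notin> range Velocity"
  shows "symbol \<phi> $ i $ j = (if i = j then diag_coef \<phi> i else 0)"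
  using assms unfolding symbol_entry
  by (cases i; cases j)
    (auto simp: matter_op_def axis_def fcomp_def vel_entry sum_distrib_left mult.assoc
      intro!: sum.neutral)

section \<open>Contraction of the symbol with frame vectors\<close>

lemma fcomp_zero_contract: "(\<Sum>\<nu>\<in>UNIV. \<phi>$\<nu> * of_real (e b$\<nu>)) = fcomp \<phi> b"
  by (simp add: fcomp_def mult.commute)

lemma wlow_contract: "(\<Sum>\<nu>\<in>UNIV. wlow \<phi> \<nu> * of_real (e b$\<nu>)) = of_real (\<Lambda> b) * fcomp \<phi> b"
proof -
  have "(\<Sum>\<nu>\<in>UNIV. wlow \<phi> \<nu> * of_real (e b$\<nu>))
      = (\<Sum>\<alpha>\<in>UNIV. of_real (\<Sum>\<nu>\<in>UNIV. shear_mixed g U $\<alpha>$\<nu> * e b$\<nu>) * \<phi>$\<alpha>)"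
    unfolding wlow_def
    by (simp add: sum_distrib_right, subst sum.swap) (simp add: sum_distrib_left mult_ac)
  also have "\<dots> = of_real (\<Lambda> b) * fcomp \<phi> b"
    unfolding shear_mixed_contract fcomp_def by (simp add: sum_distrib_left mult_ac)
  finally show ?thesis .
qed

lemma kron_contract: "(\<Sum>\<nu>\<in>UNIV. kron \<beta> \<nu> * h \<nu>) = h \<beta>"
  by (simp add: kron_def if_distrib [where f = "\<lambda>x. x * _"] cong: if_cong)

text \<open>The tensor C_pi with its lower index filled by e_b: the mixed shear then acts as the
  factor \<open>\<Lambda> b\<close>, the mixed projector removes b = 0, and T/4 is T/2 times the 1/2
  of the symmetrization.\<close>

definition C_frame :: "4 \<Rightarrow> 4 \<Rightarrow> 4 \<Rightarrow> 4 \<Rightarrow> real" where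
  "C_frame \<mu> \<beta> \<alpha> b =
     visc * (proj g U$\<mu>$\<alpha> * e b$\<beta> + proj g U$\<beta>$\<alpha> * e b$\<mu> - 2/3 * proj g U$\<mu>$\<beta> * (if b = 0 then 0 else e b$\<alpha>))
     - tpi * e 0$\<alpha> * (\<Lambda> b * e b$\<mu> * e 0$\<beta> + \<Lambda> b * e b$\<beta> * e 0$\<mu>)
     + (coef g M U delta_pipi - T / 3) * shear U$\<mu>$\<beta> * e b$\<alpha>
     + T / 4 * (proj g U$\<alpha>$\<beta> * (\<Lambda> b * e b$\<mu>) + proj g U$\<alpha>$\<mu> * (\<Lambda> b * e b$\<beta>)
         + shear U$\<alpha>$\<mu> * e b$\<beta> + shear U$\<alpha>$\<beta> * e b$\<mu>)
     - T / 3 * proj g U$\<mu>$\<beta> * (\<Lambda> b * e b$\<alpha>)"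

lemma C_shear_contract: "(\<Sum>\<nu>\<in>UNIV. C_shear g M U \<mu> \<beta> \<alpha> \<nu> * e b$\<nu>) = C_frame \<mu> \<beta> \<alpha> b"
proof -
  have "C_shear g M U \<mu> \<beta> \<alpha> \<nu> * e b$\<nu> =
     visc * (proj g U$\<mu>$\<alpha> * (kron \<beta> \<nu> * e b$\<nu>) + proj g U$\<beta>$\<alpha> * (kron \<mu> \<nu> * e b$\<nu>)
       - 2/3 * proj g U$\<mu>$\<beta> * (proj_mixed g U$\<alpha>$\<nu> * e b$\<nu>))
     - tpi * e 0$\<alpha> * (shear_mixed g U$\<mu>$\<nu> * e b$\<nu> * e 0$\<beta> + shear_mixed g U$\<beta>$\<nu> * e b$\<nu> * e 0$\<mu>)
     + (coef g M U delta_pipi - T / 3) * shear U$\<mu>$\<beta> * (kron \<alpha> \<nu> * e b$\<nu>)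
     + T / 4 * (proj g U$\<alpha>$\<beta> * (shear_mixed g U$\<mu>$\<nu> * e b$\<nu>) + proj g U$\<alpha>$\<mu> * (shear_mixed g U$\<beta>$\<nu> * e b$\<nu>)
         + shear U$\<alpha>$\<mu> * (kron \<beta> \<nu> * e b$\<nu>) + shear U$\<alpha>$\<beta> * (kron \<mu> \<nu> * e b$\<nu>))
     - T / 3 * proj g U$\<mu>$\<beta> * (shear_mixed g U$\<alpha>$\<nu> * e b$\<nu>)" for \<nu>
    unfolding C_shear_def symmetrize_def visc_def vel_entry by (simp add: field_simps)
  then show ?thesis
    unfolding C_frame_def
    by (simp only: sum.distrib sum_subtractf sum_distrib_left [symmetric] sum_distrib_right [symmetric]
        kron_contract shear_mixed_contract proj_mixed_contract)
qed

definition spatial_sq :: "('a::real_field)^4 \<Rightarrow> 'a" where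
  "spatial_sq \<phi> = (\<Sum>a\<in>{1, 2, 3}. (fcomp \<phi> a)\<^sup>2)"

definition shear_form :: "('a::real_field)^4 \<Rightarrow> 'a" where
  "shear_form \<phi> = (\<Sum>a\<in>{1, 2, 3}. of_real (\<Lambda> a) * (fcomp \<phi> a)\<^sup>2)"

definition spatial_comp :: "('a::real_field)^4 \<Rightarrow> 4 \<Rightarrow> 'a" where
  "spatial_comp \<phi> b = (if b = 0 then 0 else fcomp \<phi> b)"

text \<open>The covector enters twice: its index \<alpha> comes from the shear relaxation equation,
  its index \<beta> from the divergence of the shear in the momentum equation, once the shear
  perturbation is eliminated.\<close>

lemma C_contr_contract:
  "(\<Sum>\<nu>\<in>UNIV. (\<Sum>\<beta>\<in>UNIV. \<phi>$\<beta> * C_contr \<phi> \<mu> \<beta> \<nu>) * of_real (e b$\<nu>)) =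
     of_real visc * (vproj \<phi> \<mu> * fcomp \<phi> b + spatial_sq \<phi> * of_real (e b$\<mu>) - 2/3 * vproj \<phi> \<mu> * spatial_comp \<phi> b)
     - of_real (tpi * \<Lambda> b) * fcomp \<phi> 0 * (of_real (e b$\<mu>) * fcomp \<phi> 0 + fcomp \<phi> b * of_real (e 0$\<mu>))
     + of_real (coef g M U delta_pipi - T / 3) * wproj \<phi> \<mu> * fcomp \<phi> b
     + of_real (T / 4) * (of_real (\<Lambda> b) * spatial_sq \<phi> * of_real (e b$\<mu>) + of_real (\<Lambda> b) * vproj \<phi> \<mu> * fcomp \<phi> b
         + wproj \<phi> \<mu> * fcomp \<phi> b + shear_form \<phi> * of_real (e b$\<mu>))
     - of_real (T / 3 * \<Lambda> b) * vproj \<phi> \<mu> * fcomp \<phi> b"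
proof -
  \<comment> \<open>\<open>L\<close> is double contraction with the covector. It is linear and
    splits on products of a factor in \<alpha> and a factor in \<beta>, so every summand of C_pi can
    be evaluated separately.\<close>
  define L where "L h = (\<Sum>\<beta>\<in>UNIV. \<Sum>\<alpha>\<in>UNIV. of_real (h \<beta> \<alpha>) * \<phi>$\<alpha> * \<phi>$\<beta>)" for h
  have Ladd: "L (\<lambda>\<beta> \<alpha>. h \<beta> \<alpha> + k \<beta> \<alpha>) = L h + L k"
    and Ldiff: "L (\<lambda>\<beta> \<alpha>. h \<beta> \<alpha> - k \<beta> \<alpha>) = L h - L k"
    and Lscale: "L (\<lambda>\<beta> \<alpha>. c * h \<beta> \<alpha>) = of_real c * L h"
    and Lscale': "L (\<lambda>\<beta> \<alpha>. h \<beta> \<alpha> * c) = L h * of_real c" for h k c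
    unfolding L_def
    by (simp_all add: distrib_right left_diff_distrib distrib_left right_diff_distrib sum.distrib sum_subtractf sum_distrib_left
        sum_distrib_right mult_ac)
  have Lprod: "L (\<lambda>\<beta> \<alpha>. x \<alpha> * y \<beta>) = (\<Sum>\<alpha>\<in>UNIV. of_real (x \<alpha>) * \<phi>$\<alpha>) * (\<Sum>\<beta>\<in>UNIV. of_real (y \<beta>) * \<phi>$\<beta>)" for x y
    unfolding L_def by (simp add: sum_distrib_left sum_distrib_right mult_ac)
  have Lprod': "L (\<lambda>\<beta> \<alpha>. y \<beta> * x \<alpha>) = (\<Sum>\<alpha>\<in>UNIV. of_real (x \<alpha>) * \<phi>$\<alpha>) * (\<Sum>\<beta>\<in>UNIV. of_real (y \<beta>) * \<phi>$\<beta>)" for x y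
    using Lprod [of x y] by (simp add: mult.commute)
  have fcomp_e: "(\<Sum>\<alpha>\<in>UNIV. of_real (e a$\<alpha>) * \<phi>$\<alpha>) = fcomp \<phi> a" for a
    by (simp add: fcomp_def)
  have Lproj: "L (\<lambda>\<beta> \<alpha>. proj g U$\<beta>$\<alpha>) = spatial_sq \<phi>"
  proof -
    have "L (\<lambda>\<beta> \<alpha>. proj g U$\<beta>$\<alpha>) = (\<Sum>a\<in>{1, 2, 3}. L (\<lambda>\<beta> \<alpha>. e a$\<beta> * e a$\<alpha>))"
      unfolding proj_entry by (simp add: Ladd)
    then show ?thesis
      unfolding Lprod' fcomp_e by (simp add: spatial_sq_def power2_eq_square)
  qed
  have Lshear: "L (\<lambda>\<beta> \<alpha>. shear U$\<beta>$\<alpha>) = shear_form \<phi>"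
  proof -
    have "L (\<lambda>\<beta> \<alpha>. shear U$\<beta>$\<alpha>) = (\<Sum>a\<in>{1, 2, 3}. of_real (\<Lambda> a) * L (\<lambda>\<beta> \<alpha>. e a$\<beta> * e a$\<alpha>))"
      unfolding shear_entry by (simp add: Ladd Lscale mult.assoc)
    then show ?thesis
      unfolding Lprod' fcomp_e by (simp add: shear_form_def power2_eq_square)
  qed
  have vp: "(\<Sum>\<alpha>\<in>UNIV. of_real (proj g U$\<mu>$\<alpha>) * \<phi>$\<alpha>) = vproj \<phi> \<mu>"
    and wp: "(\<Sum>\<alpha>\<in>UNIV. of_real (shear U$\<mu>$\<alpha>) * \<phi>$\<alpha>) = wproj \<phi> \<mu>"
    by (rule vproj_eq wproj_eq)+
  have Lif: "(\<Sum>\<alpha>\<in>UNIV. of_real (if b = 0 then 0 else e b$\<alpha>) * \<phi>$\<alpha>) = spatial_comp \<phi> b"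
    by (simp add: spatial_comp_def fcomp_e)
  have "(\<Sum>\<nu>\<in>UNIV. (\<Sum>\<beta>\<in>UNIV. \<phi>$\<beta> * C_contr \<phi> \<mu> \<beta> \<nu>) * of_real (e b$\<nu>))
      = (\<Sum>\<beta>\<in>UNIV. \<Sum>\<nu>\<in>UNIV. \<Sum>\<alpha>\<in>UNIV. of_real (C_shear g M U \<mu> \<beta> \<alpha> \<nu> * e b$\<nu>) * \<phi>$\<alpha> * \<phi>$\<beta>)"
    unfolding C_contr_def
    by (simp only: sum_distrib_right, subst sum.swap)
      (simp add: sum_distrib_left sum_distrib_right mult_ac)
  also have "\<dots> = (\<Sum>\<beta>\<in>UNIV. \<Sum>\<alpha>\<in>UNIV. \<Sum>\<nu>\<in>UNIV. of_real (C_shear g M U \<mu> \<beta> \<alpha> \<nu> * e b$\<nu>) * \<phi>$\<alpha> * \<phi>$\<beta>)"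
    by (rule sum.cong [OF refl sum.swap])
  also have "\<dots> = L (\<lambda>\<beta> \<alpha>. \<Sum>\<nu>\<in>UNIV. C_shear g M U \<mu> \<beta> \<alpha> \<nu> * e b$\<nu>)"
    unfolding L_def by (simp add: sum_distrib_right)
  \<comment> \<open>Symmetry of projector and shear brings each summand into one of the shapes that
    the rules for \<open>L\<close> match.\<close>
  also have "\<dots> = L (\<lambda>\<beta> \<alpha>.
     visc * (proj g U$\<mu>$\<alpha> * e b$\<beta> + proj g U$\<beta>$\<alpha> * e b$\<mu> - 2/3 * (proj g U$\<mu>$\<beta> * (if b = 0 then 0 else e b$\<alpha>)))
     - tpi * (\<Lambda> b * (e b$\<mu> * (e 0$\<alpha> * e 0$\<beta>)) + \<Lambda> b * ((e 0$\<alpha> * e b$\<beta>) * e 0$\<mu>))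
     + (coef g M U delta_pipi - T / 3) * (shear U$\<mu>$\<beta> * e b$\<alpha>)
     + T / 4 * (\<Lambda> b * (proj g U$\<beta>$\<alpha> * e b$\<mu>) + \<Lambda> b * (proj g U$\<mu>$\<alpha> * e b$\<beta>)
         + shear U$\<mu>$\<alpha> * e b$\<beta> + shear U$\<beta>$\<alpha> * e b$\<mu>)
     - T / 3 * (\<Lambda> b * (proj g U$\<mu>$\<beta> * e b$\<alpha>)))"
    unfolding C_shear_contract C_frame_def
    by (intro arg_cong [where f = L] ext)
      (simp add: proj_sym [of _ \<mu>] shear_sym [of _ \<mu>], simp add: proj_sym shear_sym algebra_simps)
  also have "\<dots> =
     of_real visc * (vproj \<phi> \<mu> * fcomp \<phi> b + spatial_sq \<phi> * of_real (e b$\<mu>) - of_real (2/3) * (spatial_comp \<phi> b * vproj \<phi> \<mu>))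
     - of_real tpi * (of_real (\<Lambda> b) * (of_real (e b$\<mu>) * (fcomp \<phi> 0 * fcomp \<phi> 0))
        + of_real (\<Lambda> b) * ((fcomp \<phi> 0 * fcomp \<phi> b) * of_real (e 0$\<mu>)))
     + of_real (coef g M U delta_pipi - T / 3) * (fcomp \<phi> b * wproj \<phi> \<mu>)
     + of_real (T / 4) * (of_real (\<Lambda> b) * (spatial_sq \<phi> * of_real (e b$\<mu>)) + of_real (\<Lambda> b) * (vproj \<phi> \<mu> * fcomp \<phi> b)
         + wproj \<phi> \<mu> * fcomp \<phi> b + shear_form \<phi> * of_real (e b$\<mu>))
     - of_real (T / 3) * (of_real (\<Lambda> b) * (fcomp \<phi> b * vproj \<phi> \<mu>))"
    by (simp only: Ladd Ldiff Lscale Lscale' Lprod Lprod' Lproj Lshear vp wp Lif fcomp_e)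
  finally show ?thesis
    by (simp add: algebra_simps)
qed

section \<open>The Schur complement in frame components\<close>

definition P_coef :: "4 \<Rightarrow> real" where
  "P_coef b = P_eps M U * (E + \<Lambda> b) + P_n M U * U$Density
     + (coef g M U zeta + coef g M U delta_PiPi * U$Bulk + coef g M U lambda_Pipi * \<Lambda> b) / tPi
     + (visc - T / 12 * \<Lambda> b) / tpi"

text \<open>\<open>P_coef\<close> and \<open>Q_coef\<close> collect the factors of v^mu f_b and w^mu
  f_b after elimination. The T/12 in both is the difference between the T/3 of the trace terms and
  the T/4 of the symmetrized terms; the trace part of the viscous term stays separate, since it acts
  on spatial components only.\<close>

definition Q_coef :: real where
  "Q_coef = (coef g M U delta_pipi - T / 12) / tpi"

definition diag_part :: "('a::real_field)^4 \<Rightarrow> 4 \<Rightarrow> 'a" where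
  "diag_part \<phi> b = of_real (E + \<Lambda> b) * (fcomp \<phi> 0)\<^sup>2
     - (of_real visc * spatial_sq \<phi> + of_real (T / 4) * (of_real (\<Lambda> b) * spatial_sq \<phi> + shear_form \<phi>)) / of_real tpi"

text \<open>The Schur complement times z, in the basis \<open>e\<close>; the factor z removes the
  denominators. \<open>diag_part\<close> is the multiple of e_b itself, the remaining terms are
  rank-one pieces along v and w.\<close>

definition frame_block :: "('a::real_field)^4 \<Rightarrow> 'a^4^4" where
  "frame_block \<phi> = (\<chi> a b. (if a = b then diag_part \<phi> b else 0)
     - spatial_comp \<phi> a * (of_real (P_coef b + Q_coef * \<Lambda> a) * fcomp \<phi> b - of_real (2/3 * visc / tpi) * spatial_comp \<phi> b))"

lemma frame_block_column:
  "(\<Sum>a\<in>UNIV. of_real (e a$\<mu>) * frame_block \<phi> $a$b) =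
     of_real (e b$\<mu>) * diag_part \<phi> b
     - vproj \<phi> \<mu> * (of_real (P_coef b) * fcomp \<phi> b - of_real (2/3 * visc / tpi) * spatial_comp \<phi> b)
     - wproj \<phi> \<mu> * of_real Q_coef * fcomp \<phi> b"
proof -
  have 1: "(\<Sum>a\<in>UNIV. of_real (e a$\<mu>) * (if a = b then diag_part \<phi> b else 0)) = of_real (e b$\<mu>) * diag_part \<phi> b"
    by (simp add: if_distrib [where f = "\<lambda>x. _ * x"] cong: if_cong)
  have 2: "(\<Sum>a\<in>UNIV. of_real (e a$\<mu>) * spatial_comp \<phi> a) = vproj \<phi> \<mu>"
    by (simp add: sum_UNIV_4 spatial_comp_def vproj_def)
  have 3: "(\<Sum>a\<in>UNIV. of_real (e a$\<mu>) * spatial_comp \<phi> a * of_real (\<Lambda> a)) = wproj \<phi> \<mu>"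
    by (simp add: sum_UNIV_4 spatial_comp_def wproj_def mult_ac)
  have "(\<Sum>a\<in>UNIV. of_real (e a$\<mu>) * frame_block \<phi> $a$b) =
    (\<Sum>a\<in>UNIV. of_real (e a$\<mu>) * (if a = b then diag_part \<phi> b else 0)
     - of_real (e a$\<mu>) * spatial_comp \<phi> a * (of_real (P_coef b) * fcomp \<phi> b - of_real (2/3 * visc / tpi) * spatial_comp \<phi> b)
     - of_real (e a$\<mu>) * spatial_comp \<phi> a * of_real (\<Lambda> a) * (of_real Q_coef * fcomp \<phi> b))"
    unfolding frame_block_def by (intro sum.cong) (simp_all add: algebra_simps)
  then show ?thesis
    by (simp only: sum_subtractf sum_distrib_right [symmetric] 1 2 3) (simp add: mult.assoc)
qed

definition schur_block :: "('a::real_field)^4 \<Rightarrow> 'a^4^4" where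
  "schur_block \<phi> = (\<chi> \<mu> \<nu>. symbol \<phi> $ Velocity \<mu> $ Velocity \<nu> - (\<Sum>k\<in>- range Velocity.
      symbol \<phi> $ Velocity \<mu> $ k * symbol \<phi> $ k $ Velocity \<nu> / diag_coef \<phi> k))"

lemma schur_block_entry:
  assumes "fcomp \<phi> 0 \<noteq> 0" "tPi \<noteq> 0" "tpi \<noteq> 0"
  shows "fcomp \<phi> 0 * schur_block \<phi> $\<mu>$\<nu> =
     (if \<mu> = \<nu> then of_real E * (fcomp \<phi> 0)\<^sup>2 else 0) - of_real (e 0$\<mu>) * fcomp \<phi> 0 * wlow \<phi> \<nu>
     - vproj \<phi> \<mu> * (of_real (P_eps M U) * (of_real E * \<phi>$\<nu> + wlow \<phi> \<nu>)
         + of_real (P_n M U) * (of_real (U$Density) * \<phi>$\<nu>)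
         + (of_real (coef g M U zeta + coef g M U delta_PiPi * U$Bulk) * \<phi>$\<nu>
             + of_real (coef g M U lambda_Pipi) * wlow \<phi> \<nu>) / of_real tPi)
     - (\<Sum>\<beta>\<in>UNIV. \<phi>$\<beta> * C_contr \<phi> \<mu> \<beta> \<nu>) / of_real tpi"
proof -
  have "(\<Sum>\<kappa>\<in>UNIV. \<Sum>\<beta>\<in>UNIV. (if \<mu> = \<kappa> then \<phi>$\<beta> else 0) * C_contr \<phi> \<kappa> \<beta> \<nu> / (of_real tpi * fcomp \<phi> 0))
    = (\<Sum>\<kappa>\<in>UNIV. if \<mu> = \<kappa> then (\<Sum>\<beta>\<in>UNIV. \<phi>$\<beta> * C_contr \<phi> \<mu> \<beta> \<nu>) / of_real tpi / fcomp \<phi> 0 else 0)"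
    by (intro sum.cong) (auto simp: sum_divide_distrib divide_divide_eq_left)
  then have *: "(\<Sum>\<kappa>\<in>UNIV. \<Sum>\<beta>\<in>UNIV. (if \<mu> = \<kappa> then \<phi>$\<beta> else 0) * C_contr \<phi> \<kappa> \<beta> \<nu> / (of_real tpi * fcomp \<phi> 0))
    = (\<Sum>\<beta>\<in>UNIV. \<phi>$\<beta> * C_contr \<phi> \<mu> \<beta> \<nu>) / of_real tpi / fcomp \<phi> 0"
    by simp
  show ?thesis
    unfolding schur_block_def sum_Compl_range_Velocity vec_lambda_beta symbol_velocity symbol_coupling
      diag_coef.simps *
    using assms by (simp add: field_simps power2_eq_square)
qed

text \<open>Column by column this is \<open>z S F = F B\<close>, with \<open>F\<close> the frame
  matrix, \<open>S\<close> the Schur complement and \<open>B\<close> the frame block.\<close>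

lemma schur_block_frame:
  assumes z: "fcomp \<phi> 0 \<noteq> 0" and nz: "tPi \<noteq> 0" "tpi \<noteq> 0"
  shows "fcomp \<phi> 0 * (\<Sum>\<nu>\<in>UNIV. schur_block \<phi> $\<mu>$\<nu> * of_real (e b$\<nu>))
    = (\<Sum>a\<in>UNIV. of_real (e a$\<mu>) * frame_block \<phi> $a$b)"
proof -
  define c where "c = fcomp \<phi> b"
  define w where "w = of_real (\<Lambda> b) * c"
  have "fcomp \<phi> 0 * (\<Sum>\<nu>\<in>UNIV. schur_block \<phi> $\<mu>$\<nu> * of_real (e b$\<nu>)) =
    (\<Sum>\<nu>\<in>UNIV. (fcomp \<phi> 0 * schur_block \<phi> $\<mu>$\<nu>) * of_real (e b$\<nu>))"
    by (simp add: sum_distrib_left mult.assoc)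
  also have "\<dots> = (\<Sum>\<nu>\<in>UNIV. (if \<mu> = \<nu> then of_real E * (fcomp \<phi> 0)\<^sup>2 * of_real (e b$\<nu>) else 0)
     - of_real (e 0$\<mu>) * fcomp \<phi> 0 * (wlow \<phi> \<nu> * of_real (e b$\<nu>))
     - vproj \<phi> \<mu> * (of_real (P_eps M U) * (of_real E * (\<phi>$\<nu> * of_real (e b$\<nu>)) + wlow \<phi> \<nu> * of_real (e b$\<nu>))
         + of_real (P_n M U) * (of_real (U$Density) * (\<phi>$\<nu> * of_real (e b$\<nu>)))
         + (of_real (coef g M U zeta + coef g M U delta_PiPi * U$Bulk) * (\<phi>$\<nu> * of_real (e b$\<nu>))
             + of_real (coef g M U lambda_Pipi) * (wlow \<phi> \<nu> * of_real (e b$\<nu>))) / of_real tPi)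
     - (\<Sum>\<beta>\<in>UNIV. \<phi>$\<beta> * C_contr \<phi> \<mu> \<beta> \<nu>) * of_real (e b$\<nu>) / of_real tpi)"
    unfolding schur_block_entry [OF z nz] by (intro sum.cong) (auto simp: field_simps nz)
  also have "\<dots> = of_real E * (fcomp \<phi> 0)\<^sup>2 * of_real (e b$\<mu>)
     - of_real (e 0$\<mu>) * fcomp \<phi> 0 * w
     - vproj \<phi> \<mu> * (of_real (P_eps M U) * (of_real E * c + w) + of_real (P_n M U) * (of_real (U$Density) * c)
         + (of_real (coef g M U zeta + coef g M U delta_PiPi * U$Bulk) * c
             + of_real (coef g M U lambda_Pipi) * w) / of_real tPi)
     - (\<Sum>\<nu>\<in>UNIV. (\<Sum>\<beta>\<in>UNIV. \<phi>$\<beta> * C_contr \<phi> \<mu> \<beta> \<nu>) * of_real (e b$\<nu>)) / of_real tpi"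
    by (simp only: sum.distrib sum_subtractf sum_distrib_left [symmetric] sum_divide_distrib [symmetric]
        fcomp_zero_contract wlow_contract w_def c_def sum.delta' sum.delta finite UNIV_I if_True)
  \<comment> \<open>The tau_pi term of \<open>C_contr_contract\<close> does two things here: its
    part along e_0 cancels the summand with \<open>w\<close>, and its part along e_b raises the
    factor of z^2 from E to E + Lambda_b.\<close>
  also have "\<dots> = (\<Sum>a\<in>UNIV. of_real (e a$\<mu>) * frame_block \<phi> $a$b)"
    unfolding frame_block_column C_contr_contract w_def c_def diag_part_def P_coef_def Q_coef_def
    using nz by (simp add: field_simps power2_eq_square)
  finally show ?thesis .
qed

lemma symbol_mult_entry:
  "(symbol \<phi> *v \<delta>) $ r = (\<Sum>\<nu>\<in>UNIV. symbol \<phi> $ r $ Velocity \<nu> * \<delta> $ Velocity \<nu>)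
     + (\<Sum>k\<in>- range Velocity. symbol \<phi> $ r $ k * \<delta> $ k)"
proof -
  have "(\<Sum>k\<in>UNIV. symbol \<phi> $ r $ k * \<delta> $ k)
      = (\<Sum>k\<in>range Velocity. symbol \<phi> $ r $ k * \<delta> $ k) + (\<Sum>k\<in>- range Velocity. symbol \<phi> $ r $ k * \<delta> $ k)"
    by (subst sum.union_disjoint [symmetric]) (auto simp: Compl_partition)
  then show ?thesis
    by (simp add: matrix_vector_mult_def sum.reindex inj_def)
qed

text \<open>The 16 shear columns then have entries in the four velocity rows only.\<close>

lemma det_symbol_degenerate:
  fixes \<phi> :: "('a::real_field)^4"
  assumes "tpi = 0 \<or> fcomp \<phi> 0 = 0"
  shows "det (symbol \<phi>) = 0"
proof -
  \<comment> \<open>A nonzero vector annihilated by the covector, built from coordinates 0 and 1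
    alone.\<close>
  obtain x :: "4 \<Rightarrow> 'a" and \<beta> where x: "(\<Sum>\<beta>\<in>UNIV. \<phi>$\<beta> * x \<beta>) = 0" "x \<beta> \<noteq> 0"
  proof (cases "\<phi>$1 = 0")
    case True
    then show ?thesis
      by (intro that [of "\<lambda>\<beta>. if \<beta> = 1 then 1 else 0" 1])
        (simp_all add: if_distrib [where f = "\<lambda>x. _ * x"] cong: if_cong)
  next
    case False
    then show ?thesis
      by (intro that [of "\<lambda>\<beta>. if \<beta> = 0 then \<phi>$1 else if \<beta> = 1 then - \<phi>$0 else 0" 0])
        (simp_all add: sum_UNIV_4)
  qed
  \<comment> \<open>A kernel vector: a shear perturbation in the row \<mu> = 0 only. The momentum
    rows see it through its contraction with the covector, which is zero, and the shear rows
    multiply it by the vanishing tau_pi z.\<close>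
  define \<delta> where "\<delta> = (\<chi> k. case k of Shear \<mu> \<beta> \<Rightarrow> (if \<mu> = 0 then x \<beta> else 0) | _ \<Rightarrow> 0)"
  have "(symbol \<phi> *v \<delta>) $ r = 0" for r
  proof (cases "r \<in> range Velocity")
    case True
    then obtain \<mu> where r: "r = Velocity \<mu>" by blast
    have "(\<Sum>\<beta>\<in>UNIV. (if \<mu> = \<kappa> then \<phi>$\<beta> else 0) * (if \<kappa> = 0 then x \<beta> else 0))
        = (if \<mu> = \<kappa> then (\<Sum>\<beta>\<in>UNIV. if \<mu> = 0 then \<phi>$\<beta> * x \<beta> else 0) else 0)" for \<kappa>
      by (cases "\<mu> = \<kappa>"; cases "\<kappa> = 0") simp_all
    then have "(\<Sum>k\<in>- range Velocity. symbol \<phi> $ r $ k * \<delta> $ k)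
        = (\<Sum>\<kappa>\<in>UNIV. if \<mu> = \<kappa> then (\<Sum>\<beta>\<in>UNIV. if \<mu> = 0 then \<phi>$\<beta> * x \<beta> else 0) else 0)"
      unfolding sum_Compl_range_Velocity r symbol_velocity
      by (simp add: \<delta>_def)
    also have "\<dots> = 0"
      using x(1) by (cases "\<mu> = 0") simp_all
    finally show ?thesis
      by (simp add: symbol_mult_entry \<delta>_def)
  next
    case False
    have "(\<Sum>k\<in>- range Velocity. symbol \<phi> $ r $ k * \<delta> $ k) = (\<Sum>k\<in>- range Velocity. if r = k then diag_coef \<phi> r * \<delta> $ r else 0)"
      using False by (intro sum.cong) (auto simp: symbol_diagonal)
    also have "\<dots> = 0"
      using False assms by (cases r) (auto simp: \<delta>_def)
    finally show ?thesis
      by (simp add: symbol_mult_entry \<delta>_def)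
  qed
  then have "symbol \<phi> *v \<delta> = 0"
    by (simp add: vec_eq_iff)
  moreover have "\<delta> \<noteq> 0"
    using x(2) by (auto simp: \<delta>_def vec_eq_iff intro!: exI [where x = "Shear 0 \<beta>"])
  ultimately have "\<not> invertible (symbol \<phi>)"
    using matrix_left_invertible_ker [of "symbol \<phi>"] unfolding invertible_def by blast
  then show ?thesis
    by (simp add: invertible_det_nz)
qed

text \<open>The bulk column holds v^mu in the velocity rows and tau_Pi z on the diagonal, and zeros
  elsewhere. At a purely temporal covector it therefore vanishes together with tau_Pi.\<close>

lemma det_symbol_bulk_degenerate:
  fixes \<phi> :: "('a::real_field)^4"
  assumes "tPi = 0" "\<And>\<mu>. vproj \<phi> \<mu> = 0"
  shows "det (symbol \<phi>) = 0"
proof (rule det_zero_column(2))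
  have "symbol \<phi> $ r $ Bulk = 0" for r
  proof (cases "r \<in> range Velocity")
    case True
    then show ?thesis using assms(2) by (auto simp: symbol_velocity)
  next
    case False
    moreover have "Bulk \<notin> range Velocity" by auto
    ultimately show ?thesis using assms(1) by (simp add: symbol_diagonal)
  qed
  then show "column Bulk (symbol \<phi>) = 0"
    by (simp add: column_def vec_eq_iff)
qed

section \<open>The spatial 3 x 3 determinant in squared variables\<close>

definition kappa :: "4 \<Rightarrow> 4 \<Rightarrow> real" where
  "kappa a b = P_coef b + Q_coef * \<Lambda> a - 2/3 * visc / tpi"

text \<open>From here on x stands for z^2 and \<open>y a\<close> for the square of the spatial
  component f_a. The spatial block has the entries \<open>diag_entry\<close> on the diagonal minus
  \<open>f_a f_b kappa a b\<close> everywhere.\<close>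

definition diag_shift :: "(4 \<Rightarrow> 'a::real_field) \<Rightarrow> 4 \<Rightarrow> 'a" where
  "diag_shift y a = (of_real visc * (\<Sum>b\<in>{1, 2, 3}. y b)
     + of_real (T / 4) * (of_real (\<Lambda> a) * (\<Sum>b\<in>{1, 2, 3}. y b) + (\<Sum>b\<in>{1, 2, 3}. of_real (\<Lambda> b) * y b))) / of_real tpi"

definition diag_entry :: "'a::real_field \<Rightarrow> (4 \<Rightarrow> 'a) \<Rightarrow> 4 \<Rightarrow> 'a" where
  "diag_entry x y a = of_real (E + \<Lambda> a) * x - diag_shift y a"

text \<open>Products of off-diagonal entries along the 2-cycles, and in \<open>off_triple\<close>
  along both 3-cycles. A cycle enters and leaves each of its indices once, so every f_a occurs
  squared; this is why the determinant can be written in \<open>y\<close>.\<close>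

definition off_pair :: "(4 \<Rightarrow> 'a::real_field) \<Rightarrow> 4 \<Rightarrow> 4 \<Rightarrow> 'a" where
  "off_pair y a b = y a * y b * of_real (kappa a b * kappa b a)"

definition off_triple :: "(4 \<Rightarrow> 'a::real_field) \<Rightarrow> 'a" where
  "off_triple y = y 1 * y 2 * y 3 *
     of_real (kappa 1 2 * kappa 2 3 * kappa 3 1 + kappa 1 3 * kappa 3 2 * kappa 2 1)"

definition spatial_det :: "'a::real_field \<Rightarrow> (4 \<Rightarrow> 'a) \<Rightarrow> 'a" where
  "spatial_det x y = (let D = (\<lambda>a. diag_entry x y a - y a * of_real (kappa a a)) in
     D 1 * D 2 * D 3 - off_triple y
       - D 1 * off_pair y 2 3 - D 2 * off_pair y 1 3 - D 3 * off_pair y 1 2)"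

lemma diag_part_eq: "diag_part \<phi> a = diag_entry ((fcomp \<phi> 0)\<^sup>2) (\<lambda>a. (fcomp \<phi> a)\<^sup>2) a"
  unfolding diag_part_def diag_entry_def diag_shift_def spatial_sq_def shear_form_def by simp

lemma det_frame_block:
  "det (frame_block \<phi>) = diag_part \<phi> 0 * spatial_det ((fcomp \<phi> 0)\<^sup>2) (\<lambda>a. (fcomp \<phi> a)\<^sup>2)"
proof -
  define f :: "3 \<Rightarrow> 4" where "f i = (if i = 1 then 1 else if i = 2 then 2 else 3)" for i
  have f: "f 1 = 1" "f 2 = 2" "f 3 = 3"
    by (simp_all add: f_def)
  have "inj f"
    unfolding inj_def forall_3 f by simp
  have range: "range f = {1, 2, 3}"
    unfolding UNIV_3 by (simp add: f)
  have "- range f = {0}"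
    unfolding range using not_zero_4 by blast
  moreover have "frame_block \<phi> $ i $ j = 0" if "i \<notin> range f" "j \<noteq> i" for i j
  proof -
    have "i = 0" using that range not_zero_4 by blast
    then show ?thesis using that by (simp add: frame_block_def spatial_comp_def)
  qed
  ultimately have "det (frame_block \<phi>) = frame_block \<phi> $ 0 $ 0 * det (\<chi> i j. frame_block \<phi> $ f i $ f j)"
    using det_diagonal_rows [OF \<open>inj f\<close>, of "frame_block \<phi>"] by simp
  moreover have "frame_block \<phi> $ 0 $ 0 = diag_part \<phi> 0"
    by (simp add: frame_block_def spatial_comp_def)
  moreover have entry: "frame_block \<phi> $ a $ b = (if a = b then diag_part \<phi> b else 0) - fcomp \<phi> a * fcomp \<phi> b * of_real (kappa a b)"
    if "a \<noteq> 0" "b \<noteq> 0" for a b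
    using that by (simp add: frame_block_def spatial_comp_def kappa_def algebra_simps)
  have "det (\<chi> i j. frame_block \<phi> $ f i $ f j) = spatial_det ((fcomp \<phi> 0)\<^sup>2) (\<lambda>a. (fcomp \<phi> a)\<^sup>2)"
    unfolding det_3 spatial_det_def Let_def off_pair_def off_triple_def diag_part_eq [symmetric]
    by (simp add: f entry power2_eq_square) (simp add: algebra_simps)
  ultimately show ?thesis by simp
qed

lemma det_schur_block:
  fixes \<phi> :: "('a::real_field)^4"
  assumes z: "fcomp \<phi> 0 \<noteq> 0" and nz: "tPi \<noteq> 0" "tpi \<noteq> 0"
  shows "(fcomp \<phi> 0) ^ 4 * det (schur_block \<phi>) = det (frame_block \<phi>)"
proof -
  define F :: "'a^4^4" where "F = (\<chi> \<mu> a. of_real (e a$\<mu>))"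
  have "det F = of_real (det frame_matrix)"
    by (simp add: det_def F_def frame_matrix_def)
  then have "det F \<noteq> 0"
    using det_Fr by simp
  have "(\<chi> \<mu>. fcomp \<phi> 0 *s schur_block \<phi> $ \<mu>) ** F = F ** frame_block \<phi>"
    using schur_block_frame [OF z nz]
    by (simp add: vec_eq_iff matrix_matrix_mult_def F_def sum_distrib_left mult.assoc)
  then have "det (\<chi> \<mu>. fcomp \<phi> 0 *s schur_block \<phi> $ \<mu>) = det (frame_block \<phi>)"
    using \<open>det F \<noteq> 0\<close> by (metis det_mul mult.commute mult_right_cancel)
  then show ?thesis
    by (simp add: det_rows_mul)
qed

lemma det_symbol:
  fixes \<phi> :: "('a::real_field)^4"
  assumes nz: "tPi \<noteq> 0" "tpi \<noteq> 0"
  shows "det (symbol \<phi>) = of_real tPi * of_real tpi ^ 16 * fcomp \<phi> 0 ^ 15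
    * diag_entry ((fcomp \<phi> 0)\<^sup>2) (\<lambda>a. (fcomp \<phi> a)\<^sup>2) 0 * spatial_det ((fcomp \<phi> 0)\<^sup>2) (\<lambda>a. (fcomp \<phi> a)\<^sup>2)"
proof (cases "fcomp \<phi> 0 = 0")
  case True
  then show ?thesis using det_symbol_degenerate [of \<phi>] by simp
next
  case z: False
  have "det (symbol \<phi>) = (\<Prod>i\<in>- range Velocity. diag_coef \<phi> i) * det (schur_block \<phi>)"
    unfolding schur_block_def
  proof (rule det_Schur_complement)
    show "inj Velocity" by (simp add: inj_def)
    show "symbol \<phi> $ i $ j = (if i = j then diag_coef \<phi> i else 0)" if "i \<notin> range Velocity" "j \<notin> range Velocity" for i j
      by (rule symbol_diagonal [OF that])
    show "diag_coef \<phi> i \<noteq> 0" if "i \<notin> range Velocity" for i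
      using z nz by (cases i) auto
  qed
  also have "(\<Prod>i\<in>- range Velocity. diag_coef \<phi> i) = of_real tPi * of_real tpi ^ 16 * fcomp \<phi> 0 ^ 15 * fcomp \<phi> 0 ^ 4"
  proof -
    have "(\<Prod>\<mu>\<in>(UNIV :: 4 set). \<Prod>\<nu>\<in>(UNIV :: 4 set). of_real tpi * fcomp \<phi> 0) = of_real tpi ^ 16 * fcomp \<phi> 0 ^ 16"
      by (simp add: power_mult_distrib flip: power_mult)
    moreover have "fcomp \<phi> 0 ^ 15 * fcomp \<phi> 0 ^ 4 = fcomp \<phi> 0 * fcomp \<phi> 0 * fcomp \<phi> 0 * fcomp \<phi> 0 ^ 16"
      by (simp flip: power_add power_Suc power_Suc2 power2_eq_square)
    ultimately show ?thesis
      unfolding prod_Compl_range_Velocity diag_coef.simps by (simp add: mult_ac)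
  qed
  also have "\<dots> * det (schur_block \<phi>) = of_real tPi * of_real tpi ^ 16 * fcomp \<phi> 0 ^ 15 * det (frame_block \<phi>)"
    unfolding det_schur_block [OF z nz, symmetric] by simp
  finally show ?thesis
    unfolding det_frame_block diag_part_eq by simp
qed

end

section \<open>Cubics with all roots in the unit interval\<close>

text \<open>With roots a + ib, a - ib and r, the product of squared root differences contains
  (2ib)^2, which makes it nonpositive.\<close>

lemma cubic_discriminant_conjugate_roots:
  "cubic_discriminant (2 * a + r) (a\<^sup>2 + b\<^sup>2 + 2 * a * r) ((a\<^sup>2 + b\<^sup>2) * r)
     = - 4 * b\<^sup>2 * ((a - r)\<^sup>2 + b\<^sup>2)\<^sup>2"
  unfolding cubic_discriminant_def by (simp add: field_simps power2_eq_square power3_eq_cube)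

lemma cubic_discriminant_roots:
  "cubic_discriminant (x1 + x2 + x3) (x1 * x2 + x1 * x3 + x2 * x3) (x1 * x2 * x3)
     = ((x1 - x2) * (x1 - x3) * (x2 - x3))\<^sup>2"
  unfolding cubic_discriminant_def by (simp add: field_simps power2_eq_square power3_eq_cube)

text \<open>Besides real roots, these are sign conditions on Taylor coefficients at both ends of the
  interval: A2, A1, A0 belong to 0, and 1 - A2/3, 1 - 2/3 A2 + 1/3 A1, 1 - A2 + A1 - A0 are
  f''(1)/6, f'(1)/3 and f(1).\<close>

definition unit_interval_conditions :: "real \<Rightarrow> real \<Rightarrow> real \<Rightarrow> bool" where
  "unit_interval_conditions A2 A1 A0 \<longleftrightarrow> 0 \<le> cubic_discriminant A2 A1 A0 \<and>
     0 \<le> A2 / 3 \<and> A2 / 3 \<le> 1 \<and> 0 \<le> A1 \<and> 0 \<le> A0 \<and> 0 \<le> 1 - A2 + A1 - A0 \<and>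
     0 \<le> 1 - 2/3 * A2 + 1/3 * A1"

lemma unit_interval_conditions_imp_roots:
  assumes cond: "unit_interval_conditions A2 A1 A0"
    and root: "x ^ 3 - of_real A2 * x\<^sup>2 + of_real A1 * x - of_real A0 = (0 :: complex)"
  shows "\<exists>r\<in>{0..1}. x = of_real r"
proof -
  define a b where "a = Re x" and "b = Im x"
  have x: "x = Complex a b"
    by (simp add: a_def b_def)
  have re: "a ^ 3 - 3 * a * b\<^sup>2 - A2 * (a\<^sup>2 - b\<^sup>2) + A1 * a - A0 = 0"
    using arg_cong [OF root, of Re] unfolding x
    by (simp add: power3_eq_cube power2_eq_square algebra_simps)
  have "b * (3 * a\<^sup>2 - b\<^sup>2 - 2 * A2 * a + A1) = 0"
    using arg_cong [OF root, of Im] unfolding x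
    by (simp add: power3_eq_cube power2_eq_square algebra_simps)
  then have "b = 0 \<or> A1 = b\<^sup>2 - 3 * a\<^sup>2 + 2 * A2 * a"
    by (simp only: mult_eq_0_iff) (auto simp: algebra_simps)
  then consider "b = 0" | "b \<noteq> 0" "A1 = b\<^sup>2 - 3 * a\<^sup>2 + 2 * A2 * a"
    by blast
  then show ?thesis
  proof cases
    case 1
    have f: "a ^ 3 - A2 * a\<^sup>2 + A1 * a - A0 = 0"
      using re 1 by simp
    have "0 \<le> a"
    proof (rule ccontr)
      assume "\<not> 0 \<le> a"
      then have "a ^ 3 < 0" "0 \<le> A2 * a\<^sup>2" "A1 * a \<le> 0" "0 \<le> A0"
        using cond by (auto simp: unit_interval_conditions_def power_less_zero_eq mult_nonneg_nonpos)
      with f show False by linarith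
    qed
    moreover have "a \<le> 1"
    proof (rule ccontr)
      define y where "y = a - 1"
      assume "\<not> a \<le> 1"
      then have y: "0 < y" by (simp add: y_def)
      \<comment> \<open>Expansion about 1: all coefficients are nonnegative and the leading one is
        positive, so there is no zero at y > 0.\<close>
      have "y ^ 3 + (3 - A2) * y\<^sup>2 + (3 - 2 * A2 + A1) * y + (1 - A2 + A1 - A0) = 0"
        using f by (simp add: y_def power3_eq_cube power2_eq_square algebra_simps)
      moreover have "0 < y ^ 3" "0 \<le> (3 - A2) * y\<^sup>2" "0 \<le> (3 - 2 * A2 + A1) * y"
        using cond y by (auto simp: unit_interval_conditions_def)
      moreover have "0 \<le> 1 - A2 + A1 - A0"
        using cond by (simp add: unit_interval_conditions_def)
      ultimately show False by linarith
    qed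
    ultimately show ?thesis
      using 1 x by (intro bexI [of _ a]) (auto simp: complex_of_real_def)
  next
    case 2
    \<comment> \<open>The third root by Vieta, besides the conjugate pair a + ib and a - ib; the
      discriminant is then negative.\<close>
    define r where "r = A2 - 2 * a"
    have "A2 = 2 * a + r"
      by (simp add: r_def)
    moreover from this have A1: "A1 = a\<^sup>2 + b\<^sup>2 + 2 * a * r"
      using 2(2) by (simp add: power2_eq_square algebra_simps)
    moreover have "A0 = (a\<^sup>2 + b\<^sup>2) * r"
      using re unfolding A1 \<open>A2 = _\<close> by (simp add: power3_eq_cube power2_eq_square algebra_simps)
    ultimately have "cubic_discriminant A2 A1 A0 = - 4 * b\<^sup>2 * ((a - r)\<^sup>2 + b\<^sup>2)\<^sup>2"
      using cubic_discriminant_conjugate_roots by simp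
    moreover have "0 < (a - r)\<^sup>2 + b\<^sup>2"
      using 2(1) by (simp add: add_nonneg_pos)
    then have "0 < 4 * b\<^sup>2 * ((a - r)\<^sup>2 + b\<^sup>2)\<^sup>2"
      using 2(1) by simp
    ultimately show ?thesis
      using cond by (simp add: unit_interval_conditions_def)
  qed
qed

lemma unit_interval_conditions_if_roots:
  assumes roots: "\<And>x :: complex. x ^ 3 - of_real A2 * x\<^sup>2 + of_real A1 * x - of_real A0 = 0
      \<Longrightarrow> \<exists>r\<in>{0..1}. x = of_real r"
  shows "unit_interval_conditions A2 A1 A0"
proof -
  define f where "f x = x ^ 3 - of_real A2 * x\<^sup>2 + of_real A1 * x - of_real A0" for x :: complex
  define c :: "nat \<Rightarrow> complex" where
    "c i = (if i = 0 then - of_real A0 else if i = 1 then of_real A1 else if i = 2 then - of_real A2 else 1)" for i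
  have "c 3 \<noteq> 0"
    by (simp add: c_def)
  then have "c 0 = 0 \<or> (\<exists>i\<in>{1..3}. c i \<noteq> 0)"
    by auto
  then obtain x0 where "(\<Sum>i\<le>3. c i * x0 ^ i) = 0"
    by (rule fundamental_theorem_of_algebra)
  moreover have "(\<Sum>i\<le>3. c i * z ^ i) = f z" for z
    by (simp add: c_def f_def numeral_3_eq_3 numeral_2_eq_2)
  ultimately have "f x0 = 0" by simp
  then obtain x1 where x1: "x1 \<in> {0..1}" "f (of_real x1) = 0"
    using roots unfolding f_def by blast
  define b where "b = x1 - A2"
  define d where "d = A1 + x1 * b"
  have quot: "f x = (x - of_real x1) * (x\<^sup>2 + of_real b * x + of_real d)" for x
    using x1(2) unfolding f_def b_def d_def by (simp add: power3_eq_cube power2_eq_square algebra_simps)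
  define s where "s = csqrt (of_real (b\<^sup>2 - 4 * d))"
  have s: "s\<^sup>2 = of_real b ^ 2 - 4 * of_real d"
    by (simp add: s_def)
  have "((- of_real b + s) / 2)\<^sup>2 + of_real b * ((- of_real b + s) / 2) + of_real d
      = (s\<^sup>2 - (of_real b ^ 2 - 4 * of_real d)) / 4"
    by (simp add: power2_eq_square field_simps)
  then have quadratic: "((- of_real b + s) / 2)\<^sup>2 + of_real b * ((- of_real b + s) / 2) + of_real d = 0"
    by (simp add: s)
  then have "f ((- of_real b + s) / 2) = 0"
    unfolding quot by simp
  then obtain x2 where x2: "x2 \<in> {0..1}" "f (of_real x2) = 0" "(- of_real b + s) / 2 = of_real x2"
    using roots unfolding f_def by metis
  \<comment> \<open>The second root of the quadratic quotient, by Vieta. With all three roots at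
    hand each condition becomes a square or a sum of products of \<open>x\<^sub>i\<close> or of
    \<open>1 - x\<^sub>i\<close>.\<close>
  define x3 where "x3 = - b - x2"
  have q2: "x2\<^sup>2 + b * x2 + d = 0"
  proof -
    have "complex_of_real (x2\<^sup>2 + b * x2 + d) = 0"
      using quadratic unfolding x2(3) by simp
    then show ?thesis by (simp only: of_real_eq_0_iff)
  qed
  then have "x3\<^sup>2 + b * x3 + d = 0"
    unfolding x3_def by (simp add: power2_eq_square algebra_simps)
  then have "(of_real x3 :: complex)\<^sup>2 + of_real b * of_real x3 + of_real d = 0"
    by (metis of_real_0 of_real_add of_real_mult of_real_power)
  then have "f (of_real x3) = 0"
    unfolding quot by simp
  then obtain r where "r \<in> {0..1}" "complex_of_real x3 = of_real r"
    using roots unfolding f_def by blast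
  then have x3: "x3 \<in> {0..1}" by simp
  have A2: "A2 = x1 + x2 + x3"
    by (simp add: x3_def b_def)
  have A1: "A1 = x1 * x2 + x1 * x3 + x2 * x3"
    using q2 unfolding x3_def d_def b_def by (simp add: power2_eq_square algebra_simps)
  have "A0 = x1 ^ 3 - A2 * x1\<^sup>2 + A1 * x1"
  proof -
    have "complex_of_real (x1 ^ 3 - A2 * x1\<^sup>2 + A1 * x1 - A0) = 0"
      using x1(2) unfolding f_def by simp
    then show ?thesis by (simp only: of_real_eq_0_iff)
  qed
  then have A0: "A0 = x1 * x2 * x3"
    unfolding A2 A1 by (simp add: power3_eq_cube power2_eq_square algebra_simps)
  have "0 \<le> cubic_discriminant A2 A1 A0"
    unfolding A2 A1 A0 cubic_discriminant_roots by simp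
  moreover have "1 - A2 + A1 - A0 = (1 - x1) * (1 - x2) * (1 - x3)"
    unfolding A2 A1 A0 by (simp add: algebra_simps)
  moreover have "1 - 2/3 * A2 + 1/3 * A1 = ((1 - x1) * (1 - x2) + (1 - x1) * (1 - x3) + (1 - x2) * (1 - x3)) / 3"
    unfolding A2 A1 by (simp add: field_simps)
  ultimately show ?thesis
    using x1(1) x2(1) x3 unfolding unit_interval_conditions_def
    by (simp only:) (auto simp: A2 A1 A0)
qed

text \<open>The parameters reach every direction: k = y_3 and c = y_1 / (1 - y_3). At the vertex y_3
  = 1 any c would do, and 0 is taken.\<close>

lemma simplex_dir_sq:
  assumes "\<And>a. a \<in> {1, 2, 3} \<Longrightarrow> 0 \<le> y a" "(\<Sum>a\<in>{1, 2, 3}. y a) = 1"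
  shows "\<exists>c\<in>{0..1}. \<exists>k\<in>{0..1}. \<forall>a\<in>{1, 2, 3}. y a = dir_sq c k a"
proof -
  have y: "0 \<le> y 1" "0 \<le> y 2" "0 \<le> y 3" "y 1 + y 2 + y 3 = 1"
    using assms by auto
  show ?thesis
  proof (cases "y 3 = 1")
    case True
    then have "y 1 = 0" "y 2 = 0" using y by auto
    then show ?thesis
      using True by (intro bexI [of _ 0] bexI [of _ 1]) (auto simp: dir_sq_def)
  next
    case False
    then have "y 3 < 1" using y by auto
    then have "y 1 / (1 - y 3) * (1 - y 3) = y 1" "(1 - y 1 / (1 - y 3)) * (1 - y 3) = y 2"
      using y(4) by (simp_all add: left_diff_distrib)
    then show ?thesis
      using y \<open>y 3 < 1\<close>
      by (intro bexI [of _ "y 1 / (1 - y 3)"] bexI [of _ "y 3"]) (auto simp: dir_sq_def field_simps)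
  qed
qed

lemma sum_dir_sq: "(\<Sum>a\<in>{1, 2, 3}. dir_sq c k a) = 1"
  by (simp add: dir_sq_def algebra_simps)

lemma dir_sq_nonneg: "c \<in> {0..1} \<Longrightarrow> k \<in> {0..1} \<Longrightarrow> 0 \<le> dir_sq c k a"
  by (simp add: dir_sq_def)

section \<open>The coefficients of the cubic and the factorized determinant\<close>

context fluid_frame begin

definition enthalpy_prod :: real where
  "enthalpy_prod = (E + \<Lambda> 1) * (E + \<Lambda> 2) * (E + \<Lambda> 3)"

definition shift :: "(4 \<Rightarrow> real) \<Rightarrow> 4 \<Rightarrow> real" where
  "shift y a = diag_shift y a + y a * kappa a a"

text \<open>\<open>A2_of\<close>, \<open>A1_of\<close> and \<open>A0_of\<close> are the coefficients
  of \<open>spatial_det\<close> in x, up to alternating sign, divided by the leading coefficient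
  \<open>enthalpy_prod\<close>; each diagonal entry reads
  \<open>(E + \<Lambda> a) x - shift y a\<close>.\<close>

definition A2_of :: "(4 \<Rightarrow> real) \<Rightarrow> real" where
  "A2_of y = (shift y 1 * (E + \<Lambda> 2) * (E + \<Lambda> 3) + shift y 2 * (E + \<Lambda> 1) * (E + \<Lambda> 3)
     + shift y 3 * (E + \<Lambda> 1) * (E + \<Lambda> 2)) / enthalpy_prod"

definition A1_of :: "(4 \<Rightarrow> real) \<Rightarrow> real" where
  "A1_of y = ((E + \<Lambda> 1) * (shift y 2 * shift y 3 - off_pair y 2 3)
     + (E + \<Lambda> 2) * (shift y 1 * shift y 3 - off_pair y 1 3)
     + (E + \<Lambda> 3) * (shift y 1 * shift y 2 - off_pair y 1 2)) / enthalpy_prod"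

definition A0_of :: "(4 \<Rightarrow> real) \<Rightarrow> real" where
  "A0_of y = (shift y 1 * shift y 2 * shift y 3 + off_triple y
     - shift y 1 * off_pair y 2 3 - shift y 2 * off_pair y 1 3 - shift y 3 * off_pair y 1 2) / enthalpy_prod"

lemma diag_shift_of_real: "diag_shift (\<lambda>a. of_real (y a)) a = of_real (diag_shift y a)"
  by (simp add: diag_shift_def)

lemma off_pair_of_real: "off_pair (\<lambda>a. of_real (y a)) a b = of_real (off_pair y a b)"
  by (simp add: off_pair_def)

lemma off_triple_of_real: "off_triple (\<lambda>a. of_real (y a)) = of_real (off_triple y)"
  by (simp add: off_triple_def)

lemma spatial_det_expand:
  fixes x :: "'a::real_field"
  assumes "enthalpy_prod \<noteq> 0"
  shows "spatial_det x (\<lambda>a. of_real (y a)) =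
    of_real enthalpy_prod * (x ^ 3 - of_real (A2_of y) * x\<^sup>2 + of_real (A1_of y) * x - of_real (A0_of y))"
proof -
  have "of_real enthalpy_prod * (x ^ 3 - of_real (A2_of y) * x\<^sup>2 + of_real (A1_of y) * x - of_real (A0_of y))
    = of_real enthalpy_prod * x ^ 3 - of_real (enthalpy_prod * A2_of y) * x\<^sup>2 + of_real (enthalpy_prod * A1_of y) * x - of_real (enthalpy_prod * A0_of y)"
    by (simp add: algebra_simps)
  moreover have "spatial_det x (\<lambda>a. of_real (y a)) = \<dots>"
  proof -
    have D: "diag_entry x (\<lambda>a. of_real (y a)) a - of_real (y a) * of_real (kappa a a)
      = of_real (E + \<Lambda> a) * x - of_real (shift y a)" for a
      by (simp add: diag_entry_def diag_shift_of_real shift_def)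
    have A: "enthalpy_prod * A2_of y = shift y 1 * (E + \<Lambda> 2) * (E + \<Lambda> 3) + shift y 2 * (E + \<Lambda> 1) * (E + \<Lambda> 3)
        + shift y 3 * (E + \<Lambda> 1) * (E + \<Lambda> 2)"
      "enthalpy_prod * A1_of y = (E + \<Lambda> 1) * (shift y 2 * shift y 3 - off_pair y 2 3)
        + (E + \<Lambda> 2) * (shift y 1 * shift y 3 - off_pair y 1 3)
        + (E + \<Lambda> 3) * (shift y 1 * shift y 2 - off_pair y 1 2)"
      "enthalpy_prod * A0_of y = shift y 1 * shift y 2 * shift y 3 + off_triple y
        - shift y 1 * off_pair y 2 3 - shift y 2 * off_pair y 1 3 - shift y 3 * off_pair y 1 2"
      using assms by (simp_all add: A2_of_def A1_of_def A0_of_def)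
    have m: "enthalpy_prod = (E + \<Lambda> 1) * (E + \<Lambda> 2) * (E + \<Lambda> 3)"
      by (rule enthalpy_prod_def)
    show ?thesis
      unfolding spatial_det_def Let_def D A off_pair_of_real off_triple_of_real
      by (simp only: m of_real_add of_real_diff of_real_mult)
        (simp add: power3_eq_cube power2_eq_square algebra_simps)
  qed
  ultimately show ?thesis by simp
qed

lemma diag_shift_scale: "diag_shift (\<lambda>a. c * y a) a = c * diag_shift y a"
  by (simp add: diag_shift_def distrib_left mult_ac)

lemma diag_entry_scale: "diag_entry (c * x) (\<lambda>a. c * y a) a = c * diag_entry x y a"
  by (simp add: diag_entry_def diag_shift_scale right_diff_distrib mult_ac)

text \<open>Homogeneity in the squared components allows a covector to be normalized by v^2.\<close>

lemma spatial_det_scale: "spatial_det (c * x) (\<lambda>a. c * y a) = c ^ 3 * spatial_det x y"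
  unfolding spatial_det_def Let_def diag_entry_scale off_pair_def off_triple_def
  by (simp add: power3_eq_cube algebra_simps)

lemma diag_entry_cong:
  assumes "\<And>a. a \<in> {1, 2, 3} \<Longrightarrow> y a = y' a"
  shows "diag_entry x y a = diag_entry x y' a"
  using assms by (simp add: diag_entry_def diag_shift_def)

lemma spatial_det_cong:
  assumes "\<And>a. a \<in> {1, 2, 3} \<Longrightarrow> y a = y' a"
  shows "spatial_det x y = spatial_det x y'"
proof -
  have "diag_entry x y a = diag_entry x y' a" for a
    using assms by (rule diag_entry_cong)
  then show ?thesis
    using assms by (simp add: spatial_det_def off_pair_def off_triple_def)
qed

lemma diag_entry_speed:
  fixes x :: "'a::real_field"
  assumes "E \<noteq> 0" "tpi \<noteq> 0"
  shows "diag_entry x (\<lambda>a. of_real (dir_sq c k a)) 0 = of_real E * (x - of_real (speed_sq g M U \<Lambda> c k))"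
proof -
  have "diag_shift (dir_sq c k) 0 = E * speed_sq g M U \<Lambda> c k"
    unfolding diag_shift_def sum_dir_sq speed_sq_def Lambda_dir_def visc_def
    using assms by (simp add: Lambda_0)
  then show ?thesis
    by (simp add: diag_entry_def diag_shift_of_real Lambda_0 right_diff_distrib)
qed

section \<open>The quantities z, v and the direction parameters in the frame\<close>

lemma gprod_linear_left: "linear (\<lambda>X. gprod g X Y)"
  by (rule linearI) (simp_all add: gprod_def distrib_left distrib_right sum.distrib sum_distrib_left mult_ac)

lemma gprod_linear_right: "linear (gprod g X)"
  by (rule linearI) (simp_all add: gprod_def distrib_left distrib_right sum.distrib sum_distrib_left mult_ac)

lemma vv_frame: "vv g U \<phi> = (\<Sum>a\<in>{1, 2, 3}. fcomp \<phi> a *\<^sub>R e a)"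
  using vproj_eq [of _ \<phi>] by (simp add: vec_eq_iff vv_def matrix_vector_mult_def vproj_def mult.commute)

lemma gprod_vv_frame: "a \<in> {1, 2, 3} \<Longrightarrow> gprod g (vv g U \<phi>) (e a) = fcomp \<phi> a"
  unfolding vv_frame linear_sum [OF gprod_linear_left] linear_cmul [OF gprod_linear_left] ortho
  by (auto simp: minkowski_def)

lemma gprod_vv: "gprod g (vv g U \<phi>) (vv g U \<phi>) = spatial_sq \<phi>"
proof -
  have "gprod g (vv g U \<phi>) (vv g U \<phi>) = (\<Sum>a\<in>{1, 2, 3}. fcomp \<phi> a * gprod g (vv g U \<phi>) (e a))"
    by (subst (2) vv_frame) (simp add: linear_add [OF gprod_linear_right] linear_cmul [OF gprod_linear_right])
  then show ?thesis
    by (simp add: gprod_vv_frame spatial_sq_def power2_eq_square)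
qed

lemma zz_comp: "zz U \<phi> = fcomp \<phi> 0"
  by (simp add: zz_def fcomp_def e_0)

lemma spatial_sq_nonneg: "0 \<le> spatial_sq (\<phi> :: real^4)"
  by (simp add: spatial_sq_def sum_nonneg)

lemma covector_exists:
  fixes f :: "4 \<Rightarrow> real"
  obtains \<phi> where "\<And>a. fcomp \<phi> a = f a"
proof
  \<comment> \<open>\<open>X\<close> is the inverse of the frame matrix, and taking components is
    multiplication by the transposed frame matrix; so \<open>transpose X\<close> recovers a covector
    from its components.\<close>
  define X where "X = minkowski ** transpose frame_matrix ** g"
  have "transpose frame_matrix ** transpose X = mat 1"
    using frame_matrix_left_inverse unfolding X_def by (metis matrix_transpose_mul transpose_mat)
  then have "transpose frame_matrix *v (transpose X *v (\<chi> a. f a)) = (\<chi> a. f a)"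
    by (simp only: matrix_vector_mul_assoc matrix_vector_mul_lid)
  moreover have "fcomp \<psi> a = (transpose frame_matrix *v \<psi>) $ a" for a and \<psi> :: "real^4"
    unfolding fcomp_def matrix_vector_mult_def transpose_def frame_matrix_def by simp
  ultimately show "fcomp (transpose X *v (\<chi> a. f a)) a = f a" for a
    by (simp only: vec_lambda_beta)
qed

definition nondegenerate :: bool where
  "nondegenerate \<longleftrightarrow> tPi \<noteq> 0 \<and> tpi \<noteq> 0 \<and> (\<forall>a. E + \<Lambda> a \<noteq> 0)"

lemma nondegenerateD:
  assumes nondegenerate
  shows "tPi \<noteq> 0" "tpi \<noteq> 0" "E \<noteq> 0" "enthalpy_prod \<noteq> 0"
proof -
  have "E + \<Lambda> 0 \<noteq> 0"
    using assms unfolding nondegenerate_def by blast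
  then show "E \<noteq> 0" by (simp add: Lambda_0)
qed (use assms in \<open>simp_all add: nondegenerate_def enthalpy_prod_def\<close>)

text \<open>Substituting z = v zhat and f_a^2 = v^2 \<open>dir_sq c k a\<close> extracts v^15 from
  the power of z, v^2 from the quadratic factor and v^6 from the cubic, 23 in all.\<close>

lemma det_symbol_direction:
  assumes nd: nondegenerate and v: "vnorm g U \<phi> \<noteq> 0"
    and dir: "\<forall>a\<in>{1, 2, 3}. vhat_sq g U e \<phi> a = dir_sq c k a"
  shows "det (symbol \<phi>) = (\<Prod>a\<in>UNIV. E + \<Lambda> a) * vnorm g U \<phi> ^ 23 * tPi * tpi ^ 16
         * zhat g U \<phi> ^ 15 * (zhat g U \<phi> ^ 2 - speed_sq g M U \<Lambda> c k)
         * (zhat g U \<phi> ^ 6 - A2_of (dir_sq c k) * zhat g U \<phi> ^ 4 + A1_of (dir_sq c k) * zhat g U \<phi> ^ 2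
            - A0_of (dir_sq c k))"
proof -
  note nz = nondegenerateD [OF nd]
  define v h where "v = vnorm g U \<phi>" and "h = zhat g U \<phi>"
  have "v \<noteq> 0" using v by (simp add: v_def)
  have z: "fcomp \<phi> 0 = v * h"
    using \<open>v \<noteq> 0\<close> by (simp add: v_def h_def zhat_def zz_comp)
  have y: "(fcomp \<phi> a)\<^sup>2 = v\<^sup>2 * dir_sq c k a" if "a \<in> {1, 2, 3}" for a
  proof -
    have "(fcomp \<phi> a)\<^sup>2 / v\<^sup>2 = dir_sq c k a"
      using bspec [OF dir that] unfolding vhat_sq_def gprod_vv_frame [OF that] v_def .
    then show ?thesis
      using \<open>v \<noteq> 0\<close> by (simp add: field_simps)
  qed
  have D: "diag_entry ((fcomp \<phi> 0)\<^sup>2) (\<lambda>a. (fcomp \<phi> a)\<^sup>2) 0 = v\<^sup>2 * (E * (h\<^sup>2 - speed_sq g M U \<Lambda> c k))"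
    using diag_entry_cong [of "\<lambda>a. (fcomp \<phi> a)\<^sup>2" "\<lambda>a. v\<^sup>2 * dir_sq c k a", OF y]
      diag_entry_speed [OF nz(3,2), of "h\<^sup>2" c k]
    by (simp add: z power_mult_distrib diag_entry_scale)
  have C: "spatial_det ((fcomp \<phi> 0)\<^sup>2) (\<lambda>a. (fcomp \<phi> a)\<^sup>2) = (v\<^sup>2) ^ 3 * (enthalpy_prod * ((h\<^sup>2) ^ 3 - A2_of (dir_sq c k) * (h\<^sup>2)\<^sup>2
      + A1_of (dir_sq c k) * h\<^sup>2 - A0_of (dir_sq c k)))"
    using spatial_det_cong [of "\<lambda>a. (fcomp \<phi> a)\<^sup>2" "\<lambda>a. v\<^sup>2 * dir_sq c k a", OF y]
      spatial_det_expand [OF nz(4), of "h\<^sup>2" "dir_sq c k"]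
    by (simp add: z power_mult_distrib spatial_det_scale)
  have "(\<Prod>a\<in>UNIV. E + \<Lambda> a) = E * enthalpy_prod"
    unfolding UNIV_4_zero enthalpy_prod_def by (simp add: Lambda_0 mult_ac)
  moreover have "v ^ 23 = v ^ 15 * (v\<^sup>2 * (v\<^sup>2) ^ 3)"
    by (simp flip: power_add power_mult)
  moreover have "h ^ 6 = (h\<^sup>2) ^ 3" "h ^ 4 = (h\<^sup>2)\<^sup>2"
    by (simp_all flip: power_mult)
  ultimately show ?thesis
    unfolding det_symbol [OF nz(1,2)] D C v_def [symmetric] h_def [symmetric]
    by (simp add: z power_mult_distrib mult_ac)
qed

text \<open>Existence is \<open>det_symbol_direction\<close>. For uniqueness, a direction leaves
  zhat free, so two cubics that fit agree at every positive x = zhat^2 at which the other factors do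
  not vanish, and three such values suffice.\<close>

lemma cubic_coeffs_eq:
  assumes nd: nondegenerate and ck: "c \<in> {0..1}" "k \<in> {0..1}"
  shows "cubic_coeffs g M U e \<Lambda> c k = (A2_of (dir_sq c k), A1_of (dir_sq c k), A0_of (dir_sq c k))"
proof -
  let ?A2 = "A2_of (dir_sq c k)" and ?A1 = "A1_of (dir_sq c k)" and ?A0 = "A0_of (dir_sq c k)"
  let ?s = "speed_sq g M U \<Lambda> c k"
  have unique: "B2 = ?A2 \<and> B1 = ?A1 \<and> B0 = ?A0"
    if B: "\<forall>\<phi>. vnorm g U \<phi> \<noteq> 0 \<and> (\<forall>a\<in>{1, 2, 3}. vhat_sq g U e \<phi> a = dir_sq c k a) \<longrightarrow>
       det (symbol \<phi>) = (\<Prod>a\<in>UNIV. E + \<Lambda> a) * vnorm g U \<phi> ^ 23 * tPi * tpi ^ 16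
         * zhat g U \<phi> ^ 15 * (zhat g U \<phi> ^ 2 - ?s)
         * (zhat g U \<phi> ^ 6 - B2 * zhat g U \<phi> ^ 4 + B1 * zhat g U \<phi> ^ 2 - B0)" for B2 B1 B0
  proof -
    have eq: "(?A2 - B2) * x\<^sup>2 - (?A1 - B1) * x + (?A0 - B0) = 0" if x: "0 < x" "x \<noteq> ?s" for x
    proof -
      obtain \<phi> where \<phi>: "\<And>a. fcomp \<phi> a = (if a = 0 then sqrt x else sqrt (dir_sq c k a))"
        using covector_exists [of "\<lambda>a. if a = 0 then sqrt x else sqrt (dir_sq c k a)"] by blast
      have "spatial_sq \<phi> = (\<Sum>a\<in>{1, 2, 3}. dir_sq c k a)"
        using dir_sq_nonneg [OF ck] by (simp add: spatial_sq_def \<phi>)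
      then have "spatial_sq \<phi> = 1"
        unfolding sum_dir_sq .
      then have v: "vnorm g U \<phi> = 1"
        by (simp add: vnorm_def gprod_vv)
      have z: "zhat g U \<phi> = sqrt x"
        by (simp add: zhat_def v zz_comp \<phi>)
      have dir: "\<forall>a\<in>{1, 2, 3}. vhat_sq g U e \<phi> a = dir_sq c k a"
        using dir_sq_nonneg [OF ck] unfolding vhat_sq_def by (simp add: gprod_vv_frame v \<phi>)
      define K where "K = (\<Prod>a\<in>UNIV. E + \<Lambda> a) * vnorm g U \<phi> ^ 23 * tPi * tpi ^ 16
         * zhat g U \<phi> ^ 15 * (zhat g U \<phi> ^ 2 - ?s)"
      have "vnorm g U \<phi> \<noteq> 0"
        by (simp add: v)
      have "K \<noteq> 0"
        using nd x unfolding K_def v z by (simp add: nondegenerate_def)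
      moreover have "K * (zhat g U \<phi> ^ 6 - ?A2 * zhat g U \<phi> ^ 4 + ?A1 * zhat g U \<phi> ^ 2 - ?A0) = det (symbol \<phi>)"
        unfolding K_def by (rule det_symbol_direction [OF nd \<open>vnorm g U \<phi> \<noteq> 0\<close> dir, symmetric])
      moreover have "det (symbol \<phi>) = K * (zhat g U \<phi> ^ 6 - B2 * zhat g U \<phi> ^ 4 + B1 * zhat g U \<phi> ^ 2 - B0)"
        unfolding K_def using B \<open>vnorm g U \<phi> \<noteq> 0\<close> dir by blast
      ultimately have "sqrt x ^ 6 - ?A2 * sqrt x ^ 4 + ?A1 * (sqrt x)\<^sup>2 - ?A0 = sqrt x ^ 6 - B2 * sqrt x ^ 4 + B1 * (sqrt x)\<^sup>2 - B0"
        unfolding z by (metis mult_left_cancel)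
      moreover have "sqrt x ^ 4 = ((sqrt x)\<^sup>2)\<^sup>2"
        by (simp flip: power_mult)
      ultimately show ?thesis
        using x by (simp add: algebra_simps)
    qed
    \<comment> \<open>The three values t + 1, t + 2, t + 3 are positive and exceed the zero
      \<open>?s\<close> of the quadratic factor.\<close>
    define t where "t = \<bar>?s\<bar>"
    have "(?A2 - B2) * (t + 1)\<^sup>2 - (?A1 - B1) * (t + 1) + (?A0 - B0) = 0"
      "(?A2 - B2) * (t + 2)\<^sup>2 - (?A1 - B1) * (t + 2) + (?A0 - B0) = 0"
      "(?A2 - B2) * (t + 3)\<^sup>2 - (?A1 - B1) * (t + 3) + (?A0 - B0) = 0"
      unfolding t_def by (intro eq; linarith)+
    moreover have "a = 0 \<and> b = 0 \<and> d = 0" if "a * (t + 1)\<^sup>2 - b * (t + 1) + d = 0"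
      "a * (t + 2)\<^sup>2 - b * (t + 2) + d = 0" "a * (t + 3)\<^sup>2 - b * (t + 3) + d = 0" for a b d :: real
    proof -
      \<comment> \<open>The second difference isolates the leading coefficient.\<close>
      have "2 * a = (a * (t + 1)\<^sup>2 - b * (t + 1) + d) - 2 * (a * (t + 2)\<^sup>2 - b * (t + 2) + d)
          + (a * (t + 3)\<^sup>2 - b * (t + 3) + d)"
        by (simp add: power2_eq_square algebra_simps)
      then have "a = 0" using that by simp
      then show ?thesis using that by (simp add: algebra_simps)
    qed
    ultimately have "?A2 - B2 = 0 \<and> ?A1 - B1 = 0 \<and> ?A0 - B0 = 0"
      by blast
    then show ?thesis by simp
  qed
  show ?thesis
    unfolding cubic_coeffs_def
  proof (rule the_equality, unfold prod.case)
    show "\<forall>\<phi>. vnorm g U \<phi> \<noteq> 0 \<and> (\<forall>a\<in>{1, 2, 3}. vhat_sq g U e \<phi> a = dir_sq c k a) \<longrightarrow>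
       det (symbol \<phi>) = (\<Prod>a\<in>UNIV. E + \<Lambda> a) * vnorm g U \<phi> ^ 23 * tPi * tpi ^ 16
         * zhat g U \<phi> ^ 15 * (zhat g U \<phi> ^ 2 - ?s)
         * (zhat g U \<phi> ^ 6 - ?A2 * zhat g U \<phi> ^ 4 + ?A1 * zhat g U \<phi> ^ 2 - ?A0)"
      using det_symbol_direction [OF nd] by blast
  next
    fix B :: "real \<times> real \<times> real"
    obtain B2 B1 B0 where B: "B = (B2, B1, B0)"
      by (metis prod_cases3)
    assume "case B of (B2, B1, B0) \<Rightarrow> \<forall>\<phi>. vnorm g U \<phi> \<noteq> 0 \<and> (\<forall>a\<in>{1, 2, 3}. vhat_sq g U e \<phi> a = dir_sq c k a) \<longrightarrow>
       det (symbol \<phi>) = (\<Prod>a\<in>UNIV. E + \<Lambda> a) * vnorm g U \<phi> ^ 23 * tPi * tpi ^ 16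
         * zhat g U \<phi> ^ 15 * (zhat g U \<phi> ^ 2 - ?s)
         * (zhat g U \<phi> ^ 6 - B2 * zhat g U \<phi> ^ 4 + B1 * zhat g U \<phi> ^ 2 - B0)"
    then show "B = (?A2, ?A1, ?A0)"
      unfolding B prod.case prod.inject by (rule unique)
  qed
qed

end

section \<open>Causality\<close>

definition complexify :: "real^'n \<Rightarrow> complex^'n" where
  "complexify \<phi> = (\<chi> i. of_real (\<phi>$i))"

lemma complexify_real: "\<forall>i. complexify \<phi> $ i \<in> \<real>"
  by (simp add: complexify_def)

lemma real_vector_complexify:
  assumes "\<forall>i. \<eta>$i \<in> \<real>"
  obtains \<phi> where "\<eta> = complexify \<phi>"
proof
  show "\<eta> = complexify (\<chi> i. Re (\<eta>$i))"
    using assms by (simp add: complexify_def vec_eq_iff)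
qed

section \<open>The characteristic polynomial and its roots in the rest frame\<close>

context fluid_frame begin

lemma fcomp_add: "fcomp (\<phi> + \<psi>) a = fcomp \<phi> a + fcomp \<psi> a"
  and fcomp_scale: "fcomp (c *s \<phi>) a = c * fcomp \<phi> a"
  and fcomp_complexify: "fcomp (complexify \<rho>) a = of_real (fcomp \<rho> a)"
  by (simp_all add: fcomp_def complexify_def distrib_left sum.distrib sum_distrib_left mult_ac)

lemma cometric_frame: "cometric g \<phi> = spatial_sq \<phi> - (fcomp \<phi> 0)\<^sup>2"
proof -
  have sq: "(\<Sum>\<alpha>\<in>UNIV. \<Sum>\<beta>\<in>UNIV. of_real (e a$\<alpha> * e a$\<beta>) * \<phi>$\<alpha> * \<phi>$\<beta>) = (fcomp \<phi> a)\<^sup>2" for a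
    unfolding fcomp_def power2_eq_square sum_product by (simp add: mult_ac)
  have "cometric g \<phi> = (\<Sum>a\<in>{1, 2, 3}. \<Sum>\<alpha>\<in>UNIV. \<Sum>\<beta>\<in>UNIV. of_real (e a$\<alpha> * e a$\<beta>) * \<phi>$\<alpha> * \<phi>$\<beta>)
      - (\<Sum>\<alpha>\<in>UNIV. \<Sum>\<beta>\<in>UNIV. of_real (e 0$\<alpha> * e 0$\<beta>) * \<phi>$\<alpha> * \<phi>$\<beta>)"
    unfolding cometric_def matrix_inv_g_entry
    by (simp add: distrib_right left_diff_distrib sum.distrib sum_subtractf)
  then show ?thesis
    unfolding sq spatial_sq_def .
qed

lemma det_coupled: "det (coupled_symbol g M U \<phi>) = cometric g \<phi> ^ 10 * det (symbol \<phi>)"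
proof -
  have "inj (Inl :: matter_var \<Rightarrow> matter_var + 10)" by simp
  moreover have range: "- range (Inl :: matter_var \<Rightarrow> matter_var + 10) = range Inr"
    by (auto simp: image_iff) (metis sumE)
  moreover have "coupled_symbol g M U \<phi> $ i $ j = 0"
    if "i \<notin> range Inl" "j \<noteq> i" for i j
    using that by (cases i; cases j) (auto simp: coupled_symbol_def)
  ultimately have "det (coupled_symbol g M U \<phi>) =
    (\<Prod>i\<in>range Inr. coupled_symbol g M U \<phi> $ i $ i) * det (\<chi> i j. coupled_symbol g M U \<phi> $ Inl i $ Inl j)"
    using det_diagonal_rows [of "Inl :: matter_var \<Rightarrow> matter_var + 10" "coupled_symbol g M U \<phi>"] by metis
  moreover have "(\<chi> i j. coupled_symbol g M U \<phi> $ Inl i $ Inl j) = symbol \<phi>"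
    by (simp add: vec_eq_iff coupled_symbol_def)
  ultimately show ?thesis
    by (simp add: prod.reindex coupled_symbol_def)
qed

text \<open>One cometric factor in place of the ten of the coupled symbol: the zeros are the
  same.\<close>

definition char_poly :: "complex^4 \<Rightarrow> complex" where
  "char_poly \<phi> = det (symbol \<phi>) * cometric g \<phi>"

lemma char_poly_coupled: "det (coupled_symbol g M U \<phi>) = 0 \<longleftrightarrow> char_poly \<phi> = 0"
  unfolding det_coupled char_poly_def by auto

lemma det_complexify: "det (symbol (complexify \<phi>)) = of_real (det (symbol \<phi>))"
  by (simp add: det_def matter_symbol_def complexify_def)

lemma cometric_complexify: "cometric g (complexify \<phi>) = of_real (cometric g \<phi>)"
  by (simp add: cometric_def complexify_def)

lemma char_poly_complexify: "char_poly (complexify \<phi>) = 0 \<longleftrightarrow> det (coupled_symbol g M U \<phi>) = 0"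
  by (simp add: char_poly_def det_complexify cometric_complexify det_coupled) blast

lemma continuous_char_poly: "continuous_on UNIV char_poly"
  unfolding char_poly_def det_def matter_symbol_def cometric_def vec_lambda_beta
  by (intro continuous_intros)

lemma holomorphic_char_poly: "(\<lambda>t. char_poly (a + t *s b)) holomorphic_on UNIV"
  unfolding char_poly_def det_def matter_symbol_def cometric_def vec_lambda_beta
    vector_add_component vector_smult_component
  by (intro holomorphic_intros)

lemma homogeneous_char_poly: "char_poly (c *s \<phi>) = c ^ (CARD(matter_var) + 2) * char_poly \<phi>"
proof -
  have "symbol (c *s \<phi>) = (\<chi> r. c *s symbol \<phi> $ r)"
    by (simp add: vec_eq_iff matter_symbol_def sum_distrib_left mult_ac)
  then have "det (symbol (c *s \<phi>)) = c ^ CARD(matter_var) * det (symbol \<phi>)"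
    by (simp add: det_rows_mul)
  moreover have "cometric g (c *s \<phi>) = c\<^sup>2 * cometric g \<phi>"
    by (simp add: cometric_def sum_distrib_left power2_eq_square mult_ac)
  ultimately show ?thesis
    by (simp add: char_poly_def power_add power2_eq_square)
qed

lemmas char_poly_direction_change =
  hyperbolic_direction_change [OF continuous_char_poly holomorphic_char_poly homogeneous_char_poly]

lemma diag_entry_zero: "diag_entry x (\<lambda>a. 0) a = of_real (E + \<Lambda> a) * x"
  by (simp add: diag_entry_def diag_shift_def)

lemma spatial_det_zero: "spatial_det x (\<lambda>a. 0) = of_real enthalpy_prod * x ^ 3"
  by (simp add: spatial_det_def diag_entry_zero off_pair_def off_triple_def enthalpy_prod_def power3_eq_cube)

text \<open>Squared speeds at which the quadratic or the cubic factor vanishes. The speeds 0, from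
  the power of z, and 1, from the cometric, are left out; they lie in the unit interval
  anyway.\<close>

definition char_roots :: "real \<Rightarrow> real \<Rightarrow> complex set" where
  "char_roots c k = {x. diag_entry x (\<lambda>a. of_real (dir_sq c k a)) 0 = 0 \<or> spatial_det x (\<lambda>a. of_real (dir_sq c k a)) = 0}"

definition admissible_roots :: bool where
  "admissible_roots \<longleftrightarrow> (\<forall>c\<in>{0..1}. \<forall>k\<in>{0..1}. \<forall>x\<in>char_roots c k. \<exists>r\<in>{0..1}. x = of_real r)"

text \<open>Only the spatial components are assumed real. Reality of the time component is
  hyperbolicity along the fluid's covector, and the bound says that the covector is not
  timelike.\<close>

lemma rest_frame_roots:
  assumes nd: nondegenerate and adm: admissible_roots
    and real: "\<And>a. a \<in> {1, 2, 3} \<Longrightarrow> fcomp \<phi> a = of_real (f a)"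
    and root: "char_poly \<phi> = 0"
  shows "\<exists>z. fcomp \<phi> 0 = of_real z \<and> z\<^sup>2 \<le> (\<Sum>a\<in>{1, 2, 3}. (f a)\<^sup>2)"
proof -
  define q where "q = (\<Sum>a\<in>{1, 2, 3}. (f a)\<^sup>2)"
  define x where "x = (fcomp \<phi> 0)\<^sup>2"
  note nz = nondegenerateD [OF nd]
  have "0 \<le> q"
    unfolding q_def by (intro sum_nonneg) simp
  have spatial_sq: "spatial_sq \<phi> = of_real q"
    using real by (simp add: spatial_sq_def q_def)
  have cong: "diag_entry x (\<lambda>a. (fcomp \<phi> a)\<^sup>2) 0 = diag_entry x (\<lambda>a. of_real ((f a)\<^sup>2)) 0"
    "spatial_det x (\<lambda>a. (fcomp \<phi> a)\<^sup>2) = spatial_det x (\<lambda>a. of_real ((f a)\<^sup>2))"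
    using real by (intro diag_entry_cong spatial_det_cong; simp)+
  have "fcomp \<phi> 0 = 0 \<or> x = of_real q \<or> diag_entry x (\<lambda>a. of_real ((f a)\<^sup>2)) 0 = 0 \<or> spatial_det x (\<lambda>a. of_real ((f a)\<^sup>2)) = 0"
    using root nz unfolding char_poly_def det_symbol [OF nz(1,2)] cometric_frame spatial_sq x_def [symmetric] cong
    by auto
  then consider "x = 0" | "x = of_real q"
    | "diag_entry x (\<lambda>a. of_real ((f a)\<^sup>2)) 0 = 0 \<or> spatial_det x (\<lambda>a. of_real ((f a)\<^sup>2)) = 0"
    unfolding x_def by auto
  then have "\<exists>r\<in>{0..1}. x = of_real (q * r)"
  proof cases
    case 1
    then show ?thesis by (intro bexI [of _ 0]) auto
  next
    case 2
    then show ?thesis by (intro bexI [of _ 1]) auto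
  next
    case 3
    show ?thesis
    proof (cases "q = 0")
      \<comment> \<open>Without a spatial part there is no direction to refer to, but the two
        factors reduce to nonzero multiples of x and x^3.\<close>
      case True
      then have f: "f a = 0" if "a \<in> {1, 2, 3}" for a
        using that sum_nonneg_eq_0_iff [of "{1, 2, 3}" "\<lambda>a. (f a)\<^sup>2"] unfolding q_def by auto
      have "diag_entry x (\<lambda>a. of_real ((f a)\<^sup>2)) 0 = diag_entry x (\<lambda>a. 0) 0"
        "spatial_det x (\<lambda>a. of_real ((f a)\<^sup>2)) = spatial_det x (\<lambda>a. 0)"
        using f by (intro diag_entry_cong spatial_det_cong; simp)+
      then have "x = 0"
        using 3 nz by (auto simp: diag_entry_zero spatial_det_zero Lambda_0)
      then show ?thesis by (intro bexI [of _ 0]) auto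
    next
      case False
      with \<open>0 \<le> q\<close> have "0 < q" by simp
      obtain c k where ck: "c \<in> {0..1}" "k \<in> {0..1}" and dir: "\<forall>a\<in>{1, 2, 3}. (f a)\<^sup>2 / q = dir_sq c k a"
      proof -
        have "(\<Sum>a\<in>{1, 2, 3}. (f a)\<^sup>2 / q) = 1"
          unfolding sum_divide_distrib [symmetric] q_def [symmetric] using \<open>0 < q\<close> by simp
        then show ?thesis
          using simplex_dir_sq [of "\<lambda>a. (f a)\<^sup>2 / q"] \<open>0 < q\<close> that by auto
      qed
      have y: "of_real ((f a)\<^sup>2) = of_real q * complex_of_real (dir_sq c k a)" if "a \<in> {1, 2, 3}" for a
        using bspec [OF dir that] \<open>0 < q\<close> by (simp add: field_simps flip: of_real_mult)
      have xq: "x = of_real q * (x / of_real q)"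
        using \<open>0 < q\<close> by simp
      have "diag_entry x (\<lambda>a. of_real ((f a)\<^sup>2)) 0
          = of_real q * diag_entry (x / of_real q) (\<lambda>a. of_real (dir_sq c k a)) 0"
        by (subst xq, subst diag_entry_scale [symmetric]) (rule diag_entry_cong [OF y])
      moreover have "spatial_det x (\<lambda>a. of_real ((f a)\<^sup>2))
          = of_real q ^ 3 * spatial_det (x / of_real q) (\<lambda>a. of_real (dir_sq c k a))"
        by (subst xq, subst spatial_det_scale [symmetric]) (rule spatial_det_cong [OF y])
      ultimately have "x / of_real q \<in> char_roots c k"
        using 3 \<open>0 < q\<close> by (auto simp: char_roots_def)
      then obtain r where "r \<in> {0..1}" "x / of_real q = of_real r"
        using adm ck unfolding admissible_roots_def by blast
      then show ?thesis
        using \<open>0 < q\<close> by (intro bexI [of _ r]) (auto simp: field_simps)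
    qed
  qed
  then obtain r where r: "r \<in> {0..1}" "x = of_real (q * r)"
    by blast
  then have "0 \<le> q * r" "q * r \<le> q"
    using \<open>0 \<le> q\<close> by (auto simp: mult_left_le)
  have "(fcomp \<phi> 0)\<^sup>2 = (of_real (sqrt (q * r)))\<^sup>2"
    using r(2) \<open>0 \<le> q * r\<close> unfolding x_def by (simp flip: of_real_power)
  then have "fcomp \<phi> 0 = of_real (sqrt (q * r)) \<or> fcomp \<phi> 0 = of_real (- sqrt (q * r))"
    by (simp add: power2_eq_iff)
  moreover have "(sqrt (q * r))\<^sup>2 \<le> q" "(- sqrt (q * r))\<^sup>2 \<le> q"
    using \<open>0 \<le> q * r\<close> \<open>q * r \<le> q\<close> by simp_all
  ultimately show ?thesis
    unfolding q_def [symmetric] by blast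
qed

lemma admissible_roots_iff:
  assumes nd: nondegenerate
  shows "admissible_roots \<longleftrightarrow> (\<forall>c\<in>{0..1}. \<forall>k\<in>{0..1}.
    unit_interval_conditions (A2_of (dir_sq c k)) (A1_of (dir_sq c k)) (A0_of (dir_sq c k)) \<and>
    0 \<le> speed_sq g M U \<Lambda> c k \<and> speed_sq g M U \<Lambda> c k \<le> 1)"
proof -
  note nz = nondegenerateD [OF nd]
  have "(\<forall>x\<in>char_roots c k. \<exists>r\<in>{0..1}. x = of_real r) \<longleftrightarrow>
    unit_interval_conditions (A2_of (dir_sq c k)) (A1_of (dir_sq c k)) (A0_of (dir_sq c k)) \<and>
    0 \<le> speed_sq g M U \<Lambda> c k \<and> speed_sq g M U \<Lambda> c k \<le> 1" for c k
  proof -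
    let ?P = "\<lambda>x :: complex. x ^ 3 - of_real (A2_of (dir_sq c k)) * x\<^sup>2 + of_real (A1_of (dir_sq c k)) * x
        - of_real (A0_of (dir_sq c k)) = 0"
    have "x \<in> char_roots c k \<longleftrightarrow> x = of_real (speed_sq g M U \<Lambda> c k) \<or> ?P x" for x
      unfolding char_roots_def mem_Collect_eq diag_entry_speed [OF nz(3,2)] spatial_det_expand [OF nz(4)]
      using nz by simp
    then have "(\<forall>x\<in>char_roots c k. Q x) \<longleftrightarrow> Q (of_real (speed_sq g M U \<Lambda> c k)) \<and> (\<forall>x. ?P x \<longrightarrow> Q x)" for Q
      unfolding Ball_def by metis
    moreover have "(\<forall>x. ?P x \<longrightarrow> (\<exists>r\<in>{0..1}. x = of_real r)) \<longleftrightarrow>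
        unit_interval_conditions (A2_of (dir_sq c k)) (A1_of (dir_sq c k)) (A0_of (dir_sq c k))"
      by (intro iffI allI impI unit_interval_conditions_if_roots; elim allE impE unit_interval_conditions_imp_roots)
    moreover have "(\<exists>r\<in>{0..1}. complex_of_real s = of_real r) \<longleftrightarrow> 0 \<le> s \<and> s \<le> 1" for s
      by auto
    ultimately show ?thesis by (simp only: conj_commute)
  qed
  then show ?thesis
    unfolding admissible_roots_def by simp
qed

text \<open>Otherwise some vector tangent to the level sets fails to be spacelike. If dx^0 has no
  spatial frame part, e_0 itself shows that its time part is nonzero; otherwise the witness
  \<open>X\<close> gives the inequality.\<close>

lemma time_covector_timelike:
  assumes "spacelike_level_sets g"
  shows "spatial_sq (axis 0 1 :: real^4) < (fcomp (axis 0 1) 0)\<^sup>2"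
proof -
  define f where "f a = e a $ 0" for a
  define F where "F = (\<Sum>a\<in>{1, 2, 3}. (f a)\<^sup>2)"
  have fcomp: "fcomp (axis 0 1) a = f a" for a
    by (simp add: fcomp_def f_def axis_def if_distrib [where f = "\<lambda>x. _ * x"] cong: if_cong)
  have pos: "0 < gprod g X X" if "X$0 = 0" "X \<noteq> 0" for X
    using assms that unfolding spacelike_level_sets_def by blast
  have "0 \<le> F"
    unfolding F_def by (intro sum_nonneg) simp
  have "F < (f 0)\<^sup>2"
  proof (cases "F = 0")
    case True
    have e0: "gprod g (e 0) (e 0) = -1"
      by (simp add: ortho minkowski_def)
    moreover have "e 0 \<noteq> 0"
      using e0 by (auto simp: gprod_def)
    ultimately have "f 0 \<noteq> 0"
      using pos [of "e 0"] by (auto simp: f_def)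
    then show ?thesis by (simp add: True)
  next
    case False
    \<comment> \<open>In the plane spanned by e_0 and \<open>\<Sum>a. f a e\<^sub>a\<close> (a
      spatial) this combination is annihilated by dx^0. Its norm is
      \<open>F (f\<^sub>0\<^sup>2 - F)\<close>, whose sign is the one in question.\<close>
    define c where "c a = (if a = 0 then F else - f 0 * f a)" for a
    define X where "X = (\<Sum>a\<in>UNIV. c a *\<^sub>R e a)"
    have "X$0 = F * f 0 - f 0 * F"
      unfolding X_def sum_component sum_UNIV_4
      by (simp add: c_def f_def [symmetric]) (simp add: F_def algebra_simps power2_eq_square)
    then have "X$0 = 0" by simp
    have inner: "gprod g X (e b) = minkowski$b$b * c b" for b
    proof -
      have "gprod g X (e b) = (\<Sum>a\<in>UNIV. c a * minkowski$a$b)"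
        unfolding X_def linear_sum [OF gprod_linear_left] linear_cmul [OF gprod_linear_left] ortho by simp
      also have "\<dots> = (\<Sum>a\<in>UNIV. if a = b then c b * minkowski$b$b else 0)"
        by (rule sum.cong) (auto simp: minkowski_def)
      finally show ?thesis by simp
    qed
    have "gprod g X X = (\<Sum>a\<in>UNIV. c a * gprod g X (e a))"
      by (subst (2) X_def) (simp add: linear_sum [OF gprod_linear_right] linear_cmul [OF gprod_linear_right])
    also have "\<dots> = - F\<^sup>2 + (f 0)\<^sup>2 * F"
      unfolding inner sum_UNIV_4
      by (simp add: c_def minkowski_def) (simp add: F_def algebra_simps power2_eq_square)
    finally have norm: "gprod g X X = F * ((f 0)\<^sup>2 - F)"
      by (simp add: power2_eq_square algebra_simps)
    have "X \<noteq> 0"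
    proof
      assume "X = 0"
      then have "gprod g X (e 0) = 0"
        by (simp add: gprod_def)
      then show False
        using False unfolding inner by (simp add: c_def minkowski_def)
    qed
    then show ?thesis
      using pos [OF \<open>X$0 = 0\<close>] \<open>0 \<le> F\<close> unfolding norm by (simp add: zero_less_mult_iff)
  qed
  then show ?thesis
    by (simp add: spatial_sq_def fcomp F_def)
qed

text \<open>Half of the light cone is convex: the sign makes the cross term
  \<open>2 r |f\<^sub>0|\<close> nonnegative.\<close>

lemma timelike_sum:
  fixes f0 r F :: real
  assumes "F < f0\<^sup>2" "0 \<le> F" "0 \<le> r"
  shows "F < (f0 + r * sgn f0)\<^sup>2" "r\<^sup>2 * F < (sgn f0 + r * f0)\<^sup>2"
proof -
  have "f0 \<noteq> 0" using assms by auto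
  then have s: "(sgn f0)\<^sup>2 = 1" "f0 * sgn f0 = \<bar>f0\<bar>"
    by (auto simp: sgn_if)
  have "(f0 + r * sgn f0)\<^sup>2 = f0\<^sup>2 + 2 * r * (f0 * sgn f0) + r\<^sup>2 * (sgn f0)\<^sup>2"
    by (simp add: power2_eq_square algebra_simps)
  then have "(f0 + r * sgn f0)\<^sup>2 = f0\<^sup>2 + 2 * r * \<bar>f0\<bar> + r\<^sup>2"
    unfolding s by simp
  moreover have "0 \<le> 2 * r * \<bar>f0\<bar>" "0 \<le> r\<^sup>2" using assms by simp_all
  ultimately show "F < (f0 + r * sgn f0)\<^sup>2"
    using assms(1) by linarith
  have "(sgn f0 + r * f0)\<^sup>2 = (sgn f0)\<^sup>2 + 2 * r * (f0 * sgn f0) + r\<^sup>2 * f0\<^sup>2"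
    by (simp add: power2_eq_square algebra_simps)
  then have "(sgn f0 + r * f0)\<^sup>2 = 1 + 2 * r * \<bar>f0\<bar> + r\<^sup>2 * f0\<^sup>2"
    unfolding s by simp
  moreover have "r\<^sup>2 * F \<le> r\<^sup>2 * f0\<^sup>2"
    using assms by (intro mult_left_mono) auto
  ultimately show "r\<^sup>2 * F < (sgn f0 + r * f0)\<^sup>2"
    using \<open>0 \<le> 2 * r * \<bar>f0\<bar>\<close> by linarith
qed

section \<open>Both implications, with \<open>\<tau>\<close> the covector dual to e_0 in the time
  orientation of dx^0\<close>

context
  fixes \<tau> :: "real^4"
  assumes level: "spacelike_level_sets g"
    and tau: "\<And>a. fcomp \<tau> a = (if a = 0 then sgn (fcomp (axis 0 1) 0) else 0)"
begin

lemma sgn_time: "(sgn (fcomp (axis 0 1 :: real^4) 0))\<^sup>2 = 1"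
proof -
  have "fcomp (axis 0 1 :: real^4) 0 \<noteq> 0"
    using time_covector_timelike [OF level] spatial_sq_nonneg [of "axis 0 1"] by auto
  then show ?thesis by (simp add: sgn_if)
qed

lemma time_plus_rest_timelike:
  assumes "0 \<le> r"
  shows "cometric g (axis 0 1 + r *s \<tau> :: real^4) < 0" "cometric g (\<tau> + r *s axis 0 1) < 0"
proof -
  have q: "spatial_sq (axis 0 1 + r *s \<tau> :: real^4) = spatial_sq (axis 0 1 :: real^4)"
    "spatial_sq (\<tau> + r *s axis 0 1) = r\<^sup>2 * spatial_sq (axis 0 1 :: real^4)"
    by (simp_all add: spatial_sq_def fcomp_add fcomp_scale tau power_mult_distrib distrib_left)
  show "cometric g (axis 0 1 + r *s \<tau> :: real^4) < 0" "cometric g (\<tau> + r *s axis 0 1) < 0"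
    using timelike_sum [OF time_covector_timelike [OF level] spatial_sq_nonneg assms]
    unfolding cometric_frame q by (simp_all add: fcomp_add fcomp_scale tau)
qed

lemma rest_timelike: "cometric g \<tau> < 0"
  using time_plus_rest_timelike(2) [of 0] by simp

lemma time_timelike: "cometric g (axis 0 1 :: real^4) < 0"
  using time_plus_rest_timelike(1) [of 0] by simp

lemma complexify_axis: "complexify (axis 0 1) $ i = (if i = 0 then 1 else 0)"
  by (simp add: complexify_def axis_def)

lemma complexify_add_scale: "complexify \<phi> + of_real r *s complexify \<psi> = complexify (\<phi> + r *s \<psi>)"
  by (simp add: complexify_def vec_eq_iff)

lemma causal_if_admissible:
  assumes nd: nondegenerate and adm: admissible_roots
  shows "causal g M U"
proof -
  have real_root: "0 \<le> cometric g \<phi>" if "char_poly (complexify \<phi>) = 0" for \<phi>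
  proof -
    from rest_frame_roots [OF nd adm fcomp_complexify that]
    obtain z where "fcomp (complexify \<phi>) 0 = of_real z" "z\<^sup>2 \<le> (\<Sum>a\<in>{1, 2, 3}. (fcomp \<phi> a)\<^sup>2)"
      by blast
    then show ?thesis
      unfolding cometric_frame spatial_sq_def fcomp_complexify by simp
  qed
  \<comment> \<open>Adding a complex multiple of \<open>\<tau>\<close> changes only the time
    component in the frame, so \<open>rest_frame_roots\<close> still applies.\<close>
  have hyp: "s \<in> \<real>" if "\<forall>i. \<eta>$i \<in> \<real>" "char_poly (\<eta> + s *s complexify \<tau>) = 0" for \<eta> s
  proof -
    from that(1) obtain \<eta>' where \<eta>: "\<eta> = complexify \<eta>'"
      by (rule real_vector_complexify)
    have "fcomp (\<eta> + s *s complexify \<tau>) a = of_real (fcomp \<eta>' a)" if "a \<in> {1, 2, 3}" for a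
      using that by (auto simp: \<eta> fcomp_add fcomp_scale fcomp_complexify tau)
    from rest_frame_roots [OF nd adm this that(2)]
    obtain z where "fcomp (\<eta> + s *s complexify \<tau>) 0 = of_real z" by auto
    then have "s * of_real (sgn (fcomp (axis 0 1) 0)) = of_real (z - fcomp \<eta>' 0)"
      by (simp add: \<eta> fcomp_add fcomp_scale fcomp_complexify tau algebra_simps)
    moreover have "s = (s * of_real (sgn (fcomp (axis 0 1) 0))) * of_real (sgn (fcomp (axis 0 1) 0))"
      using sgn_time by (simp add: mult.assoc power2_eq_square flip: of_real_mult)
    ultimately have "s = of_real (z - fcomp \<eta>' 0) * of_real (sgn (fcomp (axis 0 1) 0))"
      by simp
    then show ?thesis
      by (metis Reals_mult Reals_of_real)
  qed
  have CI: "\<phi>$0 \<in> \<real>" if "\<forall>i. i \<noteq> 0 \<longrightarrow> \<phi>$i \<in> \<real>" "det (coupled_symbol g M U \<phi>) = 0" for \<phi> :: "complex^4"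
  proof -
    \<comment> \<open>The given covector is \<open>\<eta> + \<phi>$0 dx\<^sup>0\<close> with
      \<open>\<eta>\<close> real, so (CI) is real-rootedness in direction dx^0.\<close>
    define \<eta> where "\<eta> = (\<chi> i. if i = 0 then 0 else \<phi>$i)"
    have "\<eta> + \<phi>$0 *s complexify (axis 0 1) = \<phi>"
      by (simp add: \<eta>_def vec_eq_iff complexify_axis)
    then have root: "char_poly (\<eta> + \<phi>$0 *s complexify (axis 0 1)) = 0"
      using that(2) by (simp add: char_poly_coupled)
    have \<eta>: "\<forall>i. \<eta>$i \<in> \<real>"
      using that(1) by (simp add: \<eta>_def)
    have rest: "char_poly (complexify \<tau>) \<noteq> 0"
      using real_root [of \<tau>] rest_timelike by auto
    have segment: "char_poly (complexify (axis 0 1) + of_real r *s complexify \<tau>) \<noteq> 0" if "0 \<le> r" for r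
      using real_root [of "axis 0 1 + r *s \<tau>"] time_plus_rest_timelike(1) [OF that] unfolding complexify_add_scale by auto
    show ?thesis
      by (rule char_poly_direction_change [OF hyp complexify_real rest segment \<eta> root])
  qed
  show ?thesis
    unfolding causal_def
  proof (intro conjI allI impI)
    fix \<phi> :: "complex^4"
    assume "(\<forall>i. i \<noteq> 0 \<longrightarrow> \<phi>$i \<in> \<real>) \<and> det (coupled_symbol g M U \<phi>) = 0"
    then show "\<phi>$0 \<in> \<real>" using CI by (elim conjE)
  next
    fix \<phi> :: "real^4"
    assume "det (coupled_symbol g M U \<phi>) = 0"
    then show "0 \<le> cometric g \<phi>"
      by (intro real_root) (simp only: char_poly_complexify)
  qed
qed

text \<open>(CII) forbids a vanishing determinant at the timelike \<open>\<tau>\<close>. The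
  relaxation times are settled first, because the product formula for the determinant divides by
  them.\<close>

lemma nondegenerate_if_causal:
  assumes "causal g M U"
  shows nondegenerate
proof -
  have "det (coupled_symbol g M U \<tau>) \<noteq> 0"
    using assms rest_timelike unfolding causal_def by fastforce
  then have det: "det (symbol \<tau>) \<noteq> 0"
    by (simp add: det_coupled)
  then have tpi: "tpi \<noteq> 0"
    using det_symbol_degenerate by blast
  have "vproj \<tau> \<mu> = 0" for \<mu>
    by (simp add: vproj_def tau)
  then have tPi: "tPi \<noteq> 0"
    using det det_symbol_bulk_degenerate by blast
  have "diag_entry x (\<lambda>a. (fcomp \<tau> a)\<^sup>2) 0 = diag_entry x (\<lambda>a. 0) 0"
    "spatial_det x (\<lambda>a. (fcomp \<tau> a)\<^sup>2) = spatial_det x (\<lambda>a. 0)" for x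
    by (intro diag_entry_cong spatial_det_cong; auto simp: tau)+
  then have "E + \<Lambda> 0 \<noteq> 0" "enthalpy_prod \<noteq> 0"
    using det unfolding det_symbol [OF tPi tpi] by (auto simp: diag_entry_zero spatial_det_zero)
  then have "\<forall>a. E + \<Lambda> a \<noteq> 0"
    unfolding forall_4_zero by (simp add: enthalpy_prod_def)
  then show ?thesis
    using tpi tPi by (simp add: nondegenerate_def)
qed

lemma admissible_if_causal:
  assumes causal: "causal g M U"
  shows admissible_roots
  unfolding admissible_roots_def
proof (intro ballI)
  fix c k x assume ck: "c \<in> {0..1 :: real}" "k \<in> {0..1 :: real}" and x: "x \<in> char_roots c k"
  note nz = nondegenerateD [OF nondegenerate_if_causal [OF causal]]
  have CI: "\<phi>$0 \<in> \<real>" if "\<forall>i. i \<noteq> 0 \<longrightarrow> \<phi>$i \<in> \<real>" "char_poly \<phi> = 0" for \<phi>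
    using causal that unfolding causal_def char_poly_coupled by blast
  have CII: "0 \<le> cometric g \<phi>" if "char_poly (complexify \<phi>) = 0" for \<phi>
    using causal that unfolding causal_def char_poly_complexify by blast
  \<comment> \<open>Here a multiple of dx^0 changes only coordinate 0, so (CI) is hyperbolicity in
    direction dx^0, which \<open>change\<close> then moves to \<open>\<tau>\<close>.\<close>
  have hyp: "s \<in> \<real>" if "\<forall>i. \<eta>$i \<in> \<real>" "char_poly (\<eta> + s *s complexify (axis 0 1)) = 0" for \<eta> s
  proof -
    have "\<forall>i. i \<noteq> 0 \<longrightarrow> (\<eta> + s *s complexify (axis 0 1)) $ i \<in> \<real>"
      using that(1) by (simp add: complexify_axis)
    from CI [OF this that(2)] have "\<eta>$0 + s \<in> \<real>"
      by (simp add: complexify_axis)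
    then show ?thesis
      using that(1) Reals_diff [of "\<eta>$0 + s" "\<eta>$0"] by simp
  qed
  have change: "t \<in> \<real>" if "\<forall>i. \<eta>$i \<in> \<real>" "char_poly (\<eta> + t *s complexify \<tau>) = 0" for \<eta> t
  proof -
    have time: "char_poly (complexify (axis 0 1)) \<noteq> 0"
      using CII [of "axis 0 1"] time_timelike by auto
    have segment: "char_poly (complexify \<tau> + of_real r *s complexify (axis 0 1)) \<noteq> 0" if "0 \<le> r" for r
      using CII [of "\<tau> + r *s axis 0 1"] time_plus_rest_timelike(2) [OF that] unfolding complexify_add_scale by auto
    show ?thesis
      by (rule char_poly_direction_change [OF hyp complexify_real time segment that])
  qed
  define \<sigma> where "\<sigma> = sgn (fcomp (axis 0 1 :: real^4) 0)"
  have \<sigma>: "\<sigma> * \<sigma> = 1"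
    using sgn_time by (simp add: \<sigma>_def power2_eq_square)
  obtain \<eta> where \<eta>: "\<And>a. fcomp \<eta> a = (if a = 0 then 0 else sqrt (dir_sq c k a))"
    using covector_exists [of "\<lambda>a. if a = 0 then 0 else sqrt (dir_sq c k a)"] by blast
  \<comment> \<open>A covector of unit spatial length in the direction given by \<open>c\<close>,
    \<open>k\<close>, with time component a complex square root of x, is characteristic. Once z is
    known to be real, x = z^2 is nonnegative, and (CII) gives z^2 \<le> 1.\<close>
  define z where "z = csqrt x"
  define \<phi> where "\<phi> = complexify \<eta> + (z * of_real \<sigma>) *s complexify \<tau>"
  have fcomp_0: "fcomp \<phi> 0 = z"
    using \<sigma> by (simp add: \<phi>_def fcomp_add fcomp_scale fcomp_complexify \<eta> tau mult.assoc
        flip: \<sigma>_def of_real_mult)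
  have fcomp_a: "(fcomp \<phi> a)\<^sup>2 = of_real (dir_sq c k a)" if "a \<in> {1, 2, 3}" for a
    using that dir_sq_nonneg [OF ck] by (auto simp: \<phi>_def fcomp_add fcomp_scale fcomp_complexify \<eta> tau
        simp flip: of_real_power)
  have "diag_entry x (\<lambda>a. (fcomp \<phi> a)\<^sup>2) 0 = diag_entry x (\<lambda>a. of_real (dir_sq c k a)) 0"
    "spatial_det x (\<lambda>a. (fcomp \<phi> a)\<^sup>2) = spatial_det x (\<lambda>a. of_real (dir_sq c k a))"
    by (intro diag_entry_cong spatial_det_cong fcomp_a; assumption)+
  then have "det (symbol \<phi>) = 0"
    using x unfolding det_symbol [OF nz(1,2)] fcomp_0 by (auto simp: z_def char_roots_def)
  then have root: "char_poly \<phi> = 0"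
    by (simp add: char_poly_def)
  then have "z * of_real \<sigma> \<in> \<real>"
    using change [OF complexify_real] unfolding \<phi>_def by blast
  then obtain t where t: "z * of_real \<sigma> = of_real t"
    by (auto elim: Reals_cases)
  have "z = (z * of_real \<sigma>) * of_real \<sigma>"
    using \<sigma> by (simp add: mult.assoc flip: of_real_mult)
  then have z: "z = of_real (t * \<sigma>)"
    unfolding t by simp
  have "x = z\<^sup>2"
    by (simp add: z_def)
  then have x: "x = of_real ((t * \<sigma>)\<^sup>2)"
    unfolding z by simp
  have "char_poly (complexify (\<eta> + t *s \<tau>)) = 0"
    using root unfolding \<phi>_def t complexify_add_scale .
  then have "0 \<le> cometric g (\<eta> + t *s \<tau>)"
    by (rule CII)
  moreover have "cometric g (\<eta> + t *s \<tau>) = (\<Sum>a\<in>{1, 2, 3}. dir_sq c k a) - (t * \<sigma>)\<^sup>2"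
    unfolding cometric_frame spatial_sq_def using dir_sq_nonneg [OF ck]
    by (simp add: fcomp_add fcomp_scale \<eta> tau flip: \<sigma>_def)
  ultimately have "(t * \<sigma>)\<^sup>2 \<le> 1"
    unfolding sum_dir_sq by simp
  then show "\<exists>r\<in>{0..1}. x = of_real r"
    using x by (intro bexI [of _ "(t * \<sigma>)\<^sup>2"]) auto
qed

end

lemma causal_iff_admissible:
  assumes "spacelike_level_sets g"
  shows "causal g M U \<longleftrightarrow> nondegenerate \<and> admissible_roots"
proof -
  obtain \<tau> :: "real^4" where tau: "\<And>a. fcomp \<tau> a = (if a = 0 then sgn (fcomp (axis 0 1) 0) else 0)"
    using covector_exists [of "\<lambda>a. if a = 0 then sgn (fcomp (axis 0 1) 0) else 0"] by blast
  show ?thesis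
  proof
    assume "causal g M U"
    then show "nondegenerate \<and> admissible_roots"
      by (intro conjI nondegenerate_if_causal [OF assms tau] admissible_if_causal [OF assms tau])
  next
    assume "nondegenerate \<and> admissible_roots"
    then show "causal g M U"
      by (elim conjE) (rule causal_if_admissible [OF assms tau])
  qed
qed

end

theorem corollary6:
  fixes g :: "real^4^4" and M :: fluid_model and U :: "real^matter_var"
    and e :: "4 \<Rightarrow> real^4" and \<Lambda> :: "4 \<Rightarrow> real"
  assumes "lorentzian g"
    and "spacelike_level_sets g"
    and "(\<lambda>(\<epsilon>, n). pressure M \<epsilon> n) differentiable (at (U$Energy, U$Density))"
    and "constraints g U"
    and "eigenframe g U e \<Lambda>"
  shows "causal g M U \<longleftrightarrow>
    coef g M U tau_Pi \<noteq> 0 \<and> coef g M U tau_pi \<noteq> 0 \<and>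
    (\<forall>a. enthalpy M U + \<Lambda> a \<noteq> 0) \<and>
    (\<forall>c\<in>{0..1}. \<forall>k\<in>{0..1}. \<forall>A2 A1 A0. (A2, A1, A0) = cubic_coeffs g M U e \<Lambda> c k \<longrightarrow>
       0 \<le> cubic_discriminant A2 A1 A0 \<and>
       0 \<le> A2 / 3 \<and> A2 / 3 \<le> 1 \<and> 0 \<le> A1 \<and> 0 \<le> A0 \<and>
       0 \<le> 1 - A2 + A1 - A0 \<and>
       0 \<le> 1 - 2/3 * A2 + 1/3 * A1 \<and>
       0 \<le> speed_sq g M U \<Lambda> c k \<and> speed_sq g M U \<Lambda> c k \<le> 1)"
proof -
  interpret fluid_frame g M U e \<Lambda>
    by unfold_locales fact
  have "admissible_roots \<longleftrightarrow>
    (\<forall>c\<in>{0..1}. \<forall>k\<in>{0..1}. \<forall>A2 A1 A0. (A2, A1, A0) = cubic_coeffs g M U e \<Lambda> c k \<longrightarrow>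
       unit_interval_conditions A2 A1 A0 \<and>
       0 \<le> speed_sq g M U \<Lambda> c k \<and> speed_sq g M U \<Lambda> c k \<le> 1)" if nondegenerate
    using admissible_roots_iff [OF that] cubic_coeffs_eq [OF that] by simp
  \<comment> \<open>\<open>cubic_coeffs\<close> is identified only for nondegenerate states, so the
    second conjuncts are compared under the first.\<close>
  then have "causal g M U \<longleftrightarrow> nondegenerate \<and>
    (\<forall>c\<in>{0..1}. \<forall>k\<in>{0..1}. \<forall>A2 A1 A0. (A2, A1, A0) = cubic_coeffs g M U e \<Lambda> c k \<longrightarrow>
       unit_interval_conditions A2 A1 A0 \<and>
       0 \<le> speed_sq g M U \<Lambda> c k \<and> speed_sq g M U \<Lambda> c k \<le> 1)"
    unfolding causal_iff_admissible [OF assms(2)] by (rule conj_cong [OF refl])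
  then show ?thesis
    unfolding nondegenerate_def unit_interval_conditions_def conj_assoc .
qed

end
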